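(* Assume $$\lim_{n\to\infty}\rho_n=0,\qquad \lim_{n\to\infty}\frac{\gamma_n}{\rho_n}=0,\qquad \sum_n\rho_n\gamma_n=\infty,\qquad \rho_n-\rho_{n-1}=o(\rho_n\gamma_n).$$ Assume in addition that for all $\beta\in[0,1]$, $$\gamma_n\rho_n^\beta-\gamma_{n-1}\rho_{n-1}^\beta=o(\gamma_n^2\rho_n^\beta),$$ and that, for some $\eta>0$, $$\forall C>0,\qquad \sum_n\exp\left(-C\,\frac{\rho_n^{1+\eta}}{\gamma_n}\right)<\infty.$$ Then, with probability $1$, $$\lim_{n\to\infty}\frac{1-X_n}{\rho_n}=\frac{1-p_A}{\pi}.$$
   Context: Let $0<p_B<p_A<1$ and $\pi=p_A-p_B$. Let $(\gamma_n)_{n\ge 1}$ be a non-increasing sequence of positive numbers with $\gamma_n<1$, $\sum_{n\ge 1}\gamma_n=+\infty$ and $\sum_{n}e^{-\vartheta/\gamma_n}<\infty$ for every $\vartheta>0$. Let $(\rho_n)_{n\ge 1}$ be a sequence of positive numbers with $\gamma_n\rho_n<1$. Let $(U_n)_{n\ge 1}$ be i.i.d. random variables uniformly distributed on $[0,1]$, and let $A_n,B_n$ ($n\ge1$) be events with $\mathbb{P}(A_n)=p_A$, $\mathbb{P}(B_n)=p_B$, such that the pairs $(\mathbf 1_{A_n},\mathbf 1_{B_n})$, $n\ge 1$, are independent of one another and the sequence $(\mathbf 1_{A_n},\mathbf 1_{B_n})_{n\ge1}$ is independent of $(U_n)_{n\ge1}$. The penalized two-armed bandit algorithm is the $[0,1]$-valued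 sequence $(X_n)_{n\ge0}$ with $X_0=x\in(0,1)$ and $$X_{n+1}=X_n+\gamma_{n+1}\left(\mathbf 1_{\{U_{n+1}\le X_n\}\cap A_{n+1}}(1-X_n)-\mathbf 1_{\{U_{n+1}>X_n\}\cap B_{n+1}}X_n\right)-\gamma_{n+1}\rho_{n+1}\left(X_n\mathbf 1_{\{U_{n+1}\le X_n\}\cap A_{n+1}^c}-(1-X_n)\mathbf 1_{\{U_{n+1}>X_n\}\cap B_{n+1}^c}\right),\quad n\ge0.$$ *)

theory Defs
  imports "HOL-Probability.Probability" "HOL-Library.Landau_Symbols"
begin

text \<open>
  The sequences \<open>\<gamma>\<close>, \<open>\<rho>\<close>, \<open>U\<close>, \<open>A\<close>, \<open>B\<close> are indexed by \<open>n \<ge> 1\<close>; their values at \<open>0\<close> are unconstrained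
  and never enter the recursion. For summability the single term at \<open>0\<close> is immaterial.
  The events \<open>A n\<close> and \<open>B n\<close> with the same index may depend on each other.
  Independence of the sequence of arm outcomes from \<open>U\<close> is independence of the generated
  \<open>\<sigma>\<close>-algebras, because \<open>indep_var\<close> requires both variables to have the same type.
\<close>

locale penalized_bandit = prob_space M for M :: "'a measure" +
  fixes p\<^sub>A p\<^sub>B :: real
    and \<gamma> \<rho> :: "nat \<Rightarrow> real"
    and U :: "nat \<Rightarrow> 'a \<Rightarrow> real"
    and A B :: "nat \<Rightarrow> 'a set"
    and x :: real
    and X :: "nat \<Rightarrow> 'a \<Rightarrow> real"
  assumes p_bounds: "0 < p\<^sub>B" "p\<^sub>B < p\<^sub>A" "p\<^sub>A < 1"
    and gamma_pos: "\<And>n. n \<ge> 1 \<Longrightarrow> 0 < \<gamma> n"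
    and gamma_less_1: "\<And>n. n \<ge> 1 \<Longrightarrow> \<gamma> n < 1"
    and gamma_decreasing: "\<And>n. n \<ge> 1 \<Longrightarrow> \<gamma> (Suc n) \<le> \<gamma> n"
    and gamma_sum: "filterlim (\<lambda>N. \<Sum>n=1..N. \<gamma> n) at_top sequentially"
    and gamma_exp: "\<And>\<theta>. \<theta> > 0 \<Longrightarrow> summable (\<lambda>n. exp (- \<theta> / \<gamma> n))"
    and rho_pos: "\<And>n. n \<ge> 1 \<Longrightarrow> 0 < \<rho> n"
    and gamma_rho_less_1: "\<And>n. n \<ge> 1 \<Longrightarrow> \<gamma> n * \<rho> n < 1"
    and U_indep: "indep_vars (\<lambda>_. borel) U {1..}"
    and U_uniform: "\<And>n. n \<ge> 1 \<Longrightarrow> distr M borel (U n) = uniform_measure lborel {0..1}"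
    and A_event: "\<And>n. n \<ge> 1 \<Longrightarrow> A n \<in> events"
    and B_event: "\<And>n. n \<ge> 1 \<Longrightarrow> B n \<in> events"
    and prob_A: "\<And>n. n \<ge> 1 \<Longrightarrow> prob (A n) = p\<^sub>A"
    and prob_B: "\<And>n. n \<ge> 1 \<Longrightarrow> prob (B n) = p\<^sub>B"
    and AB_indep:
      "indep_vars (\<lambda>_. borel) (\<lambda>n \<omega>. (indicator (A n) \<omega>, indicator (B n) \<omega>) :: real \<times> real) {1..}"
    and AB_U_indep:
      "indep_set
         (sets (vimage_algebra (space M)
           (\<lambda>\<omega>. \<lambda>n\<in>{1..}. (indicator (A n) \<omega>, indicator (B n) \<omega>) :: real \<times> real)
           (Pi\<^sub>M {1..} (\<lambda>_. borel))))
         (sets (vimage_algebra (space M)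
           (\<lambda>\<omega>. \<lambda>n\<in>{1..}. U n \<omega>)
           (Pi\<^sub>M {1..} (\<lambda>_. borel))))"
    and x_bounds: "0 < x" "x < 1"
    and X_0: "\<And>\<omega>. \<omega> \<in> space M \<Longrightarrow> X 0 \<omega> = x"
    and X_Suc: "\<And>n \<omega>. \<omega> \<in> space M \<Longrightarrow>
      X (Suc n) \<omega> = X n \<omega>
        + \<gamma> (Suc n) *
            (indicator ({\<omega>. U (Suc n) \<omega> \<le> X n \<omega>} \<inter> A (Suc n)) \<omega> * (1 - X n \<omega>)
             - indicator ({\<omega>. U (Suc n) \<omega> > X n \<omega>} \<inter> B (Suc n)) \<omega> * X n \<omega>)
        - \<gamma> (Suc n) * \<rho> (Suc n) *
            (X n \<omega> * indicator ({\<omega>. U (Suc n) \<omega> \<le> X n \<omega>} \<inter> - A (Suc n)) \<omega>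
             - (1 - X n \<omega>) * indicator ({\<omega>. U (Suc n) \<omega> > X n \<omega>} \<inter> - B (Suc n)) \<omega>)"

end

theory Submission
  imports Defs
begin

text \<open>
Write \<open>Y = 1 - X\<close>, \<open>\<pi> = p\<^sub>A - p\<^sub>B\<close> and \<open>q = 1 - p\<^sub>A\<close>. Given the past, the mean increment of \<open>X\<close> at a step is \<open>\<gamma>\<close>
times \<open>\<pi> X (1 - X) - \<rho> (q X\<^sup>2 - (1 - p\<^sub>B) (1 - X)\<^sup>2)\<close>, and its mean square is at most
\<open>\<gamma>\<^sup>2 (X (1 - X) + \<rho>\<^sup>2)\<close>. Near \<open>X = 1\<close> the drift of \<open>Y\<close> is therefore about \<open>\<gamma> (q \<rho> - \<pi> Y)\<close>, whose
zero is \<open>Y = (q / \<pi>) \<rho>\<close>, and the noise has variance at most \<open>\<gamma>\<^sup>2 (Y + \<rho>\<^sup>2)\<close>, which is small where \<open>Y\<close> is small.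
Two things remain: \<open>X\<close> reaches the neighbourhood of \<open>1\<close> and stays there, and the noise cannot be seen on
the scale \<open>\<rho>\<close>.

Convergence to \<open>1\<close>. On \<open>{0..1 - \<delta>}\<close> the drift is eventually at least a multiple of \<open>\<rho>\<close>. As
\<open>\<Sum>\<rho>\<^sub>n \<gamma>\<^sub>n\<close> diverges and \<open>X\<close> is bounded, \<open>X\<close> cannot remain in this interval
(\<open>AE_exceeds_once\<close>). A descent from above \<open>1 - \<delta>\<close> to below \<open>1 - 2 \<delta>\<close> goes against the drift: started at
time \<open>n\<close> it has probability at most a constant times \<open>exp (- \<theta> \<delta> / \<gamma>\<^sub>n)\<close>, because
\<open>exp (- (\<theta> / \<gamma>\<^sub>n) X)\<close> is a supermartingale below \<open>1 - \<delta>\<close> (\<open>prob_crossing_le\<close>). These bounds are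
summable, so almost surely only finitely many descents take place (\<open>AE_X_tendsto_1\<close>).

The rate. Let \<open>\<sigma>\<close> be \<open>1\<close> or \<open>-1\<close> and \<open>V\<^sub>n = exp ((\<theta> / \<gamma>\<^sub>n) \<sigma> (Y\<^sub>n - a \<rho>\<^sub>n))\<close>. The bounds on drift and
variance give \<open>E (V\<^sub>n\<^sub>+\<^sub>1 | past) \<le> V\<^sub>n\<close> to the power \<open>1 - \<kappa> \<gamma>\<^sub>n\<close>, for suitable small \<open>\<theta>\<close>
and \<open>\<kappa>\<close> near \<open>\<pi>\<close>, as soon as \<open>a\<close> lies strictly on the correct side of \<open>q / \<pi>\<close>. The regularity
assumptions on \<open>\<rho>\<close> and \<open>\<gamma>\<close> ensure that the change of \<open>\<gamma>\<^sub>n\<close> and \<open>\<rho>\<^sub>n\<close> from one step to the next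
is negligible in this inequality. Since \<open>v\<^sup>s \<le> s v + (1 - s)\<close> for \<open>0 \<le> s \<le> 1\<close>, the expectations of \<open>V\<^sub>n\<close> are
bounded (\<open>exponential_moment_bound\<close>), hence the event \<open>\<sigma> (Y\<^sub>n - a \<rho>\<^sub>n) > \<epsilon> \<rho>\<^sub>n\<close> has probability
\<open>O (exp (- \<theta> \<epsilon> \<rho>\<^sub>n / \<gamma>\<^sub>n))\<close>, which is summable, and the Borel-Cantelli lemma concludes
(\<open>AE_eventually_le\<close>). For \<open>\<sigma> = 1\<close> the inequality needs \<open>Y\<close> to be small, and this is why convergence to
\<open>1\<close> comes first.

Conditional expectations appear only integrated against indicators of events of the past, and stopping
times are replaced by decreasing sequences of such events.
\<close>

section \<open>Two elementary bounds for the exponential function\<close>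

text \<open>
For negative \<open>u\<close> put \<open>v = - u\<close>, pass to reciprocals and use \<open>(1 - v + v\<^sup>2) (1 + v + v\<^sup>2 / 2) \<ge> 1\<close>.
\<close>
lemma exp_le_quadratic: "u \<le> 1 \<Longrightarrow> exp u \<le> 1 + u + u\<^sup>2" for u :: real
proof (cases "u \<ge> 0")
  case False
  define v where "v = - u"
  have v: "0 \<le> v" "1 + v + v\<^sup>2 / 2 \<le> exp v"
    using False exp_lower_Taylor_quadratic[of v] by (simp_all add: v_def)
  have "1 \<le> 1 + v\<^sup>2 / 2 + v ^ 3 / 2 + v ^ 4 / 2"
    using v by simp
  also have "\<dots> = (1 - v + v\<^sup>2) * (1 + v + v\<^sup>2 / 2)"
    by (simp add: field_simps eval_nat_numeral)
  also have "\<dots> \<le> (1 - v + v\<^sup>2) * exp v"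
  proof -
    have "0 \<le> 3 / 4 + (v - 1 / 2)\<^sup>2" by simp
    then have "0 \<le> 1 - v + v\<^sup>2" by (simp add: power2_eq_square field_simps)
    then show ?thesis using v by (intro mult_left_mono)
  qed
  finally show ?thesis
    by (simp add: v_def exp_minus field_simps)
qed (simp add: exp_bound)

text \<open>
Convexity of the exponential between \<open>0\<close> and \<open>L\<close>. With \<open>V = exp L\<close> it reads \<open>V\<^sup>s \<le> s V + (1 - s)\<close> and
replaces Jensen's inequality in a recursion for \<open>E V\<close>.
\<close>
lemma exp_mult_le: "exp (s * L) \<le> s * exp L + (1 - s)" if "0 \<le> s" "s \<le> 1" for s L :: real
  using convex_onD[OF exp_convex, of s 0 L] that by (simp add: algebra_simps)

context penalized_bandit
begin

section \<open>The filtration of the algorithm and independence from the past\<close>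

text \<open>
All randomness is put into a single family, so that independence of any two disjoint blocks of it can be
read off from one statement. The tag \<open>False\<close> marks the uniform variable, padded by a dummy \<open>0\<close>, and \<open>True\<close>
the pair of arm outcomes.
\<close>
fun draw :: "bool \<times> nat \<Rightarrow> 'a \<Rightarrow> real \<times> real" where
  "draw (False, k) \<omega> = (U k \<omega>, 0)"
| "draw (True, k) \<omega> = (indicator (A k) \<omega>, indicator (B k) \<omega>)"

text \<open>
The \<open>\<sigma>\<close>-algebra generated by the draws with index in \<open>I\<close>; \<open>past n\<close> is the natural filtration of the
algorithm at time \<open>n\<close>.
\<close>
definition gen :: "(bool \<times> nat) set \<Rightarrow> 'a measure" where
  "gen I = vimage_algebra (space M) (\<lambda>\<omega>. \<lambda>i\<in>I. draw i \<omega>) (Pi\<^sub>M I (\<lambda>_. borel))"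

definition past :: "nat \<Rightarrow> 'a measure" where
  "past n = gen (UNIV \<times> {1..n})"

lemma space_gen [simp]: "space (gen I) = space M"
  by (simp add: gen_def)

lemma space_past [simp]: "space (past n) = space M"
  by (simp add: past_def)

lemma draw_eqs:
  "draw (False, k) = (\<lambda>\<omega>. (U k \<omega>, 0))"
  "draw (True, k) = (\<lambda>\<omega>. (indicator (A k) \<omega>, indicator (B k) \<omega>))"
  by (rule ext, simp)+

lemma draw_measurable: "k \<ge> 1 \<Longrightarrow> draw (b, k) \<in> borel_measurable M"
proof -
  assume "k \<ge> 1"
  then have [measurable]: "A k \<in> events" "B k \<in> events" "U k \<in> borel_measurable M"
    using A_event B_event U_indep by (auto simp: indep_vars_def2)
  have "draw (True, k) \<in> borel_measurable M" "draw (False, k) \<in> borel_measurable M"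
    unfolding draw_eqs borel_prod [symmetric] by measurable
  then show ?thesis
    by (cases b) auto
qed

text \<open>
An intersection of finitely many cylinder events splits into an arm part and a uniform part. The two parts
are independent by the mutual independence of the two sequences, and each factorizes by the independence
within its own sequence.
\<close>
lemma draw_indep: "indep_vars (\<lambda>_. borel) draw (UNIV \<times> {1..})"
proof -
  define F where "F i = {draw i -` S \<inter> space M |S. S \<in> sets borel}" for i
  let ?VA = "vimage_algebra (space M)
      (\<lambda>\<omega>. \<lambda>n\<in>{1..}. (indicator (A n) \<omega>, indicator (B n) \<omega>) :: real \<times> real) (Pi\<^sub>M {1..} (\<lambda>_. borel))"
  let ?VU = "vimage_algebra (space M) (\<lambda>\<omega>. \<lambda>n\<in>{1..}. U n \<omega>) (Pi\<^sub>M {1..} (\<lambda>_. borel))"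
  have mT: "draw (True, k) \<in> borel_measurable ?VA" if "k \<ge> 1" for k
  proof -
    have "(\<lambda>\<omega>. \<lambda>n\<in>{1..}. (indicator (A n) \<omega>, indicator (B n) \<omega>) :: real \<times> real)
        \<in> measurable ?VA (Pi\<^sub>M {1..} (\<lambda>_. borel))"
      by (rule measurable_vimage_algebra1) (auto simp: space_PiM)
    from measurable_compose[OF this measurable_component_singleton[of k]] that
    show ?thesis by (simp add: draw_eqs)
  qed
  have mF: "draw (False, k) \<in> borel_measurable ?VU" if "k \<ge> 1" for k
  proof -
    have "(\<lambda>\<omega>. \<lambda>n\<in>{1..}. U n \<omega>) \<in> measurable ?VU (Pi\<^sub>M {1..} (\<lambda>_. borel))"
      by (rule measurable_vimage_algebra1) (auto simp: space_PiM)
    from measurable_compose[OF this measurable_component_singleton[of k]] that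
    have "U k \<in> borel_measurable ?VU" by simp
    then show ?thesis
      unfolding draw_eqs borel_prod [symmetric] by measurable
  qed
  have FT: "F (True, k) \<subseteq> sets ?VA" if "k \<ge> 1" for k
    using measurable_sets[OF mT[OF that]] by (auto simp: F_def)
  have FF: "F (False, k) \<subseteq> sets ?VU" if "k \<ge> 1" for k
    using measurable_sets[OF mF[OF that]] by (auto simp: F_def)
  have iT: "indep_sets (\<lambda>k. F (True, k)) {1..}"
    using AB_indep by (simp add: indep_vars_def2 F_def draw_eqs)
  have iF: "indep_sets (\<lambda>k. F (False, k)) {1..}"
  proof -
    have "indep_vars (\<lambda>_. borel) (\<lambda>k. (\<lambda>u. (u, 0 :: real)) \<circ> U k) {1..}"
      by (rule indep_vars_compose[OF U_indep]) (simp add: borel_prod [symmetric])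
    then show ?thesis
      by (simp add: indep_vars_def2 F_def comp_def draw_eqs)
  qed
  have part: "prob (space M \<inter> (\<Inter>k\<in>K. E k)) = (\<Prod>k\<in>K. prob (E k))"
    if "indep_sets G {1..}" "K \<subseteq> {1..}" "finite K" "\<And>k. k \<in> K \<Longrightarrow> E k \<in> G k"
      "\<And>k. k \<in> K \<Longrightarrow> E k \<subseteq> space M" for E G and K :: "nat set"
  proof (cases "K = {}")
    case False
    then have "space M \<inter> (\<Inter>k\<in>K. E k) = (\<Inter>k\<in>K. E k)"
      using that(5) by auto
    then show ?thesis
      using indep_setsD[OF that(1,2) False that(3)] that(4) by auto
  qed (simp add: prob_space)
  have sub: "F i \<subseteq> events" if "i \<in> UNIV \<times> {1..}" for i
    using that draw_measurable by (auto simp: F_def)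
  have "indep_sets F (UNIV \<times> {1..})"
  proof (rule indep_setsI)
    fix E J
    assume J: "J \<noteq> {}" "J \<subseteq> UNIV \<times> {1::nat..}" "finite J" "\<forall>j\<in>J. E j \<in> F j"
    define K where "K b = {k. (b, k) \<in> J}" for b
    have K: "K b \<subseteq> {1..}" for b
      using J(2) by (auto simp: K_def)
    have finK: "finite (K b)" for b
    proof (rule finite_subset)
      show "K b \<subseteq> snd ` J" by (force simp: K_def)
    qed (use J(3) in simp)
    have Jeq: "J = Pair True ` K True \<union> Pair False ` K False"
    proof (rule set_eqI)
      fix i show "i \<in> J \<longleftrightarrow> i \<in> Pair True ` K True \<union> Pair False ` K False"
        by (cases i; cases "fst i") (auto simp: K_def)
    qed
    have Esp: "E j \<subseteq> space M" if "j \<in> J" for j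
      using J(4) that by (auto simp: F_def)
    let ?E = "\<lambda>b. space M \<inter> (\<Inter>k\<in>K b. E (b, k))"
    have eq: "(\<Inter>j\<in>J. E j) = ?E True \<inter> ?E False"
    proof -
      have "(\<Inter>j\<in>J. E j) = (\<Inter>k\<in>K True. E (True, k)) \<inter> (\<Inter>k\<in>K False. E (False, k))"
        by (subst Jeq) (simp add: INT_Un image_image)
      moreover have "(\<Inter>j\<in>J. E j) \<subseteq> space M"
        using J(1) Esp by blast
      ultimately show ?thesis by blast
    qed
    have "?E True \<in> sets ?VA"
    proof (cases "K True = {}")
      case True
      then show ?thesis using sets.top[of ?VA] by simp
    next
      case False
      have "E (True, k) \<in> sets ?VA" if "k \<in> K True" for k
        using that J(4) FT[of k] K[of True] by (auto simp only: K_def mem_Collect_eq subset_iff atLeast_iff)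
      then have "(\<Inter>k\<in>K True. E (True, k)) \<in> sets ?VA"
        using False finK by (intro sets.finite_INT) auto
      then show ?thesis
        using sets.top[of ?VA] by (intro sets.Int) simp_all
    qed
    moreover have "?E False \<in> sets ?VU"
    proof (cases "K False = {}")
      case True
      then show ?thesis using sets.top[of ?VU] by simp
    next
      case False
      have "E (False, k) \<in> sets ?VU" if "k \<in> K False" for k
        using that J(4) FF[of k] K[of False] by (auto simp only: K_def mem_Collect_eq subset_iff atLeast_iff)
      then have "(\<Inter>k\<in>K False. E (False, k)) \<in> sets ?VU"
        using False finK by (intro sets.finite_INT) auto
      then show ?thesis
        using sets.top[of ?VU] by (intro sets.Int) simp_all
    qed
    ultimately have "prob (\<Inter>j\<in>J. E j) = prob (?E True) * prob (?E False)"
      unfolding eq by (rule indep_setD[OF AB_U_indep])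
    also have "\<dots> = (\<Prod>k\<in>K True. prob (E (True, k))) * (\<Prod>k\<in>K False. prob (E (False, k)))"
      using J(4) Esp
      by (intro arg_cong2[where f="(*)"] part[OF iT K finK] part[OF iF K finK]) (auto simp: K_def)
    also have "\<dots> = (\<Prod>j\<in>J. prob (E j))"
      by (subst Jeq, subst prod.union_disjoint) (use finK in \<open>auto simp: prod.reindex inj_on_def\<close>)
    finally show "prob (\<Inter>j\<in>J. E j) = (\<Prod>j\<in>J. prob (E j))" .
  qed (use sub in auto)
  then show ?thesis
    using draw_measurable by (auto simp: indep_vars_def2 F_def[abs_def])
qed

lemma gen_draw: "i \<in> I \<Longrightarrow> draw i \<in> borel_measurable (gen I)"
proof -
  assume "i \<in> I"
  have "(\<lambda>\<omega>. \<lambda>i\<in>I. draw i \<omega>) \<in> measurable (gen I) (Pi\<^sub>M I (\<lambda>_. borel))"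
    unfolding gen_def by (rule measurable_vimage_algebra1) (auto simp: space_PiM)
  from measurable_compose[OF this measurable_component_singleton[OF \<open>i \<in> I\<close>]] \<open>i \<in> I\<close>
  show ?thesis by simp
qed

lemma gen_U: "(False, k) \<in> I \<Longrightarrow> U k \<in> borel_measurable (gen I)"
  using measurable_compose[OF gen_draw[of "(False, k)" I, folded borel_prod] measurable_fst]
  by (simp add: draw_eqs)

lemma gen_A: "(True, k) \<in> I \<Longrightarrow> (indicator (A k) :: 'a \<Rightarrow> real) \<in> borel_measurable (gen I)"
  using measurable_compose[OF gen_draw[of "(True, k)" I, folded borel_prod] measurable_fst]
  by (simp add: draw_eqs)

lemma gen_B: "(True, k) \<in> I \<Longrightarrow> (indicator (B k) :: 'a \<Rightarrow> real) \<in> borel_measurable (gen I)"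
  using measurable_compose[OF gen_draw[of "(True, k)" I, folded borel_prod] measurable_snd]
  by (simp add: draw_eqs)

lemma gen_mono:
  assumes "I \<subseteq> J"
  shows "sets (gen I) \<subseteq> sets (gen J)"
proof -
  have "(\<lambda>\<omega>. \<lambda>i\<in>I. draw i \<omega>) \<in> measurable (gen J) (Pi\<^sub>M I (\<lambda>_. borel))"
    using assms gen_draw by (intro measurable_restrict) auto
  from measurable_sets[OF this] show ?thesis
    unfolding gen_def[of I] sets_vimage_algebra
    by (intro sets.sigma_sets_subset[of _ "gen J", simplified]) auto
qed

lemma gen_events: "I \<subseteq> UNIV \<times> {1..} \<Longrightarrow> sets (gen I) \<subseteq> events"
proof -
  assume I: "I \<subseteq> UNIV \<times> {1..}"
  have "(\<lambda>\<omega>. \<lambda>i\<in>I. draw i \<omega>) \<in> measurable M (Pi\<^sub>M I (\<lambda>_. borel))"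
    using I draw_measurable by (intro measurable_restrict) auto
  from measurable_sets[OF this] show ?thesis
    unfolding gen_def[of I] sets_vimage_algebra
    by (intro sets.sigma_sets_subset) auto
qed

lemma gen_measurable_mono:
  "I \<subseteq> J \<Longrightarrow> f \<in> borel_measurable (gen I) \<Longrightarrow> f \<in> borel_measurable (gen J)"
  by (rule measurable_mono[THEN subsetD, of borel borel "gen I"]) (use gen_mono in auto)

lemma gen_measurable_M:
  "I \<subseteq> UNIV \<times> {1..} \<Longrightarrow> f \<in> measurable (gen I) N \<Longrightarrow> f \<in> measurable M N"
  by (rule measurable_mono[THEN subsetD, of N N "gen I"]) (use gen_events in auto)

lemma gen_indep_set:
  assumes "I \<inter> J = {}" "I \<subseteq> UNIV \<times> {1..}" "J \<subseteq> UNIV \<times> {1..}"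
  shows "indep_set (sets (gen I)) (sets (gen J))"
  using indep_var_restrict[OF draw_indep assms]
  unfolding indep_var_eq gen_def sets_vimage_algebra by (rule conjunct2)

lemma gen_indep:
  assumes "I \<inter> J = {}" "I \<subseteq> UNIV \<times> {1..}" "J \<subseteq> UNIV \<times> {1..}"
    and f: "f \<in> measurable (gen I) S" and g: "g \<in> measurable (gen J) T"
  shows "indep_var S f T g"
proof -
  have "indep_set (sets (gen I)) (sets (gen J))"
    by (rule gen_indep_set[OF assms(1-3)])
  moreover have "sigma_sets (space M) {f -` E \<inter> space M |E. E \<in> sets S} \<subseteq> sets (gen I)"
    using measurable_sets[OF f] by (intro sets.sigma_sets_subset[of _ "gen I", simplified]) auto
  moreover have "sigma_sets (space M) {g -` E \<inter> space M |E. E \<in> sets T} \<subseteq> sets (gen J)"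
    using measurable_sets[OF g] by (intro sets.sigma_sets_subset[of _ "gen J", simplified]) auto
  ultimately have "indep_set (sigma_sets (space M) {f -` E \<inter> space M |E. E \<in> sets S})
      (sigma_sets (space M) {g -` E \<inter> space M |E. E \<in> sets T})"
    unfolding indep_set_def by - (erule indep_sets_mono_sets, auto split: bool.splits)
  then show ?thesis
    using gen_measurable_M[OF assms(2) f] gen_measurable_M[OF assms(3) g]
    unfolding indep_var_eq by (intro conjI)
qed

section \<open>The Markov property in integrated form\<close>

lemma X_Suc_cases:
  assumes "\<omega> \<in> space M"
  shows "X (Suc n) \<omega> =
    (if U (Suc n) \<omega> \<le> X n \<omega>
     then if \<omega> \<in> A (Suc n) then X n \<omega> + \<gamma> (Suc n) * (1 - X n \<omega>)
       else X n \<omega> - \<gamma> (Suc n) * \<rho> (Suc n) * X n \<omega>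
     else if \<omega> \<in> B (Suc n) then X n \<omega> - \<gamma> (Suc n) * X n \<omega>
       else X n \<omega> + \<gamma> (Suc n) * \<rho> (Suc n) * (1 - X n \<omega>))"
  unfolding X_Suc[OF assms, of n]
  by (cases "U (Suc n) \<omega> \<le> X n \<omega>"; cases "\<omega> \<in> A (Suc n)"; cases "\<omega> \<in> B (Suc n)") (auto simp: not_le algebra_simps)

lemma step_range:
  fixes s z :: real
  assumes "s \<in> {0..1}" "z \<in> {0..1}"
  shows "z + s * (1 - z) \<in> {0..1}" "z - s * z \<in> {0..1}"
  using assms mult_nonneg_nonneg[of "1 - s" "1 - z"] mult_nonneg_nonneg[of "1 - s" z]
    mult_nonneg_nonneg[of s z] mult_nonneg_nonneg[of s "1 - z"]
  by (auto simp: algebra_simps)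

lemma X_range: "\<omega> \<in> space M \<Longrightarrow> X n \<omega> \<in> {0..1}"
proof (induction n)
  case 0
  then show ?case using X_0 x_bounds by simp
next
  case (Suc n)
  have "\<gamma> (Suc n) \<in> {0..1}" "\<gamma> (Suc n) * \<rho> (Suc n) \<in> {0..1}"
    using gamma_pos[of "Suc n"] gamma_less_1[of "Suc n"] rho_pos[of "Suc n"] gamma_rho_less_1[of "Suc n"]
    by auto
  moreover have "X n \<omega> \<in> {0..1}"
    using Suc by simp
  ultimately show ?case
    by (simp only: X_Suc_cases[OF Suc.prems] step_range split: if_split) blast
qed

lemma past_measurable_M: "f \<in> measurable (past n) N \<Longrightarrow> f \<in> measurable M N"
  unfolding past_def by (erule gen_measurable_M[rotated]) auto

lemma past_event: "E \<in> sets (past n) \<Longrightarrow> E \<in> events"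
  unfolding past_def by (rule subsetD[OF gen_events]) auto

lemma X_past: "m \<le> n \<Longrightarrow> X m \<in> borel_measurable (past n)"
proof (induction m)
  case 0
  show ?case
    by (subst measurable_cong[where g = "\<lambda>_. x"]) (simp_all add: X_0)
next
  case (Suc m)
  let ?u = "\<lambda>\<omega>. of_bool (U (Suc m) \<omega> \<le> X m \<omega>) :: real"
  have [measurable]: "X m \<in> borel_measurable (past n)"
    using Suc by simp
  have [measurable]: "U (Suc m) \<in> borel_measurable (past n)"
    "(indicator (A (Suc m)) :: 'a \<Rightarrow> real) \<in> borel_measurable (past n)"
    "(indicator (B (Suc m)) :: 'a \<Rightarrow> real) \<in> borel_measurable (past n)"
    unfolding past_def by (rule gen_U gen_A gen_B; use Suc in simp)+
  have "(\<lambda>\<omega>. X m \<omega> + \<gamma> (Suc m) *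
            (?u \<omega> * indicator (A (Suc m)) \<omega> * (1 - X m \<omega>) - (1 - ?u \<omega>) * indicator (B (Suc m)) \<omega> * X m \<omega>)
        - \<gamma> (Suc m) * \<rho> (Suc m) *
            (X m \<omega> * ?u \<omega> * (1 - indicator (A (Suc m)) \<omega>)
             - (1 - X m \<omega>) * (1 - ?u \<omega>) * (1 - indicator (B (Suc m)) \<omega>))) \<in> borel_measurable (past n)"
    by measurable
  then show ?case
    by (rule measurable_cong[THEN iffD2, rotated])
      (simp add: X_Suc_cases split: split_indicator)
qed

lemma X_measurable [measurable]: "X n \<in> borel_measurable M"
  using past_measurable_M X_past by blast

text \<open>
\<open>U\<^sub>n\<^sub>+\<^sub>1\<close> is independent of the past and uniform, hence falls below \<open>X\<^sub>n\<close> with conditional probability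
\<open>X\<^sub>n\<close>. Taking the identity of the sample space as a random variable with values in \<open>past n\<close> turns this into
Fubini's theorem, and no factorization of \<open>\<phi>\<close> through the draws has to be constructed.
\<close>
lemma expectation_draw_below:
  assumes \<phi>: "\<phi> \<in> borel_measurable (past n)" and bound: "\<And>\<omega>. \<omega> \<in> space M \<Longrightarrow> \<bar>\<phi> \<omega>\<bar> \<le> c"
  shows "expectation (\<lambda>\<omega>. \<phi> \<omega> * of_bool (U (Suc n) \<omega> \<le> X n \<omega>)) = expectation (\<lambda>\<omega>. \<phi> \<omega> * X n \<omega>)"
proof -
  note \<phi> [measurable]
  have [measurable]: "X n \<in> borel_measurable (past n)"
    by (rule X_past) simp
  let ?P = "distr M (past n) (\<lambda>\<omega>. \<omega>)" and ?Q = "distr M borel (U (Suc n))"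
  let ?h = "\<lambda>(\<omega>, u). \<phi> \<omega> * of_bool (u \<le> X n \<omega>)"
  have [measurable]: "(\<lambda>\<omega>. \<omega>) \<in> measurable M (past n)"
    by (rule past_measurable_M[of _ n]) simp
  have [measurable]: "U (Suc n) \<in> borel_measurable M"
    using U_indep by (auto simp: indep_vars_def2)
  interpret P: prob_space ?P by (rule prob_space_distr) simp
  interpret Q: prob_space ?Q by (rule prob_space_distr) simp
  interpret PQ: pair_prob_space ?P ?Q ..
  have distr: "?P \<Otimes>\<^sub>M ?Q = distr M (past n \<Otimes>\<^sub>M borel) (\<lambda>\<omega>. (\<omega>, U (Suc n) \<omega>))"
  proof (rule pair_measure_eqI)
    show "sets (?P \<Otimes>\<^sub>M ?Q) = sets (distr M (past n \<Otimes>\<^sub>M borel) (\<lambda>\<omega>. (\<omega>, U (Suc n) \<omega>)))"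
      by (simp cong: sets_pair_measure_cong)
    fix E S assume "E \<in> sets ?P" "S \<in> sets ?Q"
    then have E: "E \<in> sets (past n)" and S: "S \<in> sets borel"
      by simp_all
    have "indep_set (sets (past n)) (sets (gen {(False, Suc n)}))"
      unfolding past_def by (rule gen_indep_set) auto
    moreover have "U (Suc n) -` S \<inter> space M \<in> sets (gen {(False, Suc n)})"
      using measurable_sets[OF gen_U[of "Suc n" "{(False, Suc n)}"] S] by simp
    ultimately have "prob (E \<inter> (U (Suc n) -` S \<inter> space M)) = prob E * prob (U (Suc n) -` S \<inter> space M)"
      using E by (intro indep_setD)
    moreover have "(\<lambda>\<omega>. (\<omega>, U (Suc n) \<omega>)) -` (E \<times> S) \<inter> space M = E \<inter> (U (Suc n) -` S \<inter> space M)"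
      by auto
    moreover have "E \<inter> space M = E"
      using sets.sets_into_space[OF E] by auto
    ultimately show "emeasure ?P E * emeasure ?Q S = emeasure (distr M (past n \<Otimes>\<^sub>M borel) (\<lambda>\<omega>. (\<omega>, U (Suc n) \<omega>))) (E \<times> S)"
      using E S by (simp add: emeasure_distr emeasure_eq_measure ennreal_mult [symmetric])
  qed unfold_locales
  have h: "?h \<in> borel_measurable (past n \<Otimes>\<^sub>M borel)"
    by measurable
  have "integrable (?P \<Otimes>\<^sub>M ?Q) ?h"
  proof (rule PQ.integrable_const_bound)
    show "?h \<in> borel_measurable (?P \<Otimes>\<^sub>M ?Q)"
      using h by (simp cong: measurable_cong_sets)
    show "AE z in ?P \<Otimes>\<^sub>M ?Q. norm (?h z) \<le> c"
      using bound by (intro AE_I2) (force simp: space_pair_measure split: prod.splits)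
  qed
  have "expectation (\<lambda>\<omega>. \<phi> \<omega> * of_bool (U (Suc n) \<omega> \<le> X n \<omega>)) = (\<integral>z. ?h z \<partial>(?P \<Otimes>\<^sub>M ?Q))"
    unfolding distr using h by (subst integral_distr) auto
  also have "\<dots> = (\<integral>\<omega>. (\<integral>u. ?h (\<omega>, u) \<partial>?Q) \<partial>?P)"
    by (rule PQ.integral_fst'[symmetric]) fact
  also have "\<dots> = (\<integral>\<omega>. \<phi> \<omega> * X n \<omega> \<partial>?P)"
  proof (rule Bochner_Integration.integral_cong)
    fix \<omega> assume "\<omega> \<in> space ?P"
    then have X: "X n \<omega> \<in> {0..1}"
      using X_range by simp
    have "(\<integral>u. ?h (\<omega>, u) \<partial>?Q) = \<phi> \<omega> * (\<integral>u. indicator {..X n \<omega>} u \<partial>?Q)"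
      by (simp add: of_bool_def indicator_def)
    also have "\<dots> = \<phi> \<omega> * measure (uniform_measure lborel {0..1}) {..X n \<omega>}"
      using U_uniform[of "Suc n"] by simp
    also have "{0..1} \<inter> {..X n \<omega>} = {0..X n \<omega>}"
      using X by auto
    then have "measure (uniform_measure lborel {0..1}) {..X n \<omega>} = X n \<omega>"
      using X by simp
    finally show "(\<integral>u. ?h (\<omega>, u) \<partial>?Q) = \<phi> \<omega> * X n \<omega>" .
  qed simp
  also have "\<dots> = expectation (\<lambda>\<omega>. \<phi> \<omega> * X n \<omega>)"
    by (subst integral_distr) auto
  finally show ?thesis .
qed

text \<open>
Here \<open>\<phi>\<close> may also depend on \<open>U\<^sub>n\<^sub>+\<^sub>1\<close>: which arm is played does not influence the arm outcomes.
\<close>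
lemma expectation_times_arm:
  assumes "\<phi> \<in> borel_measurable (gen (UNIV \<times> {1..n} \<union> {(False, Suc n)}))"
    and bound: "\<And>\<omega>. \<omega> \<in> space M \<Longrightarrow> \<bar>\<phi> \<omega>\<bar> \<le> c"
  shows "expectation (\<lambda>\<omega>. \<phi> \<omega> * indicator (A (Suc n)) \<omega>) = p\<^sub>A * expectation \<phi>"
    and "expectation (\<lambda>\<omega>. \<phi> \<omega> * indicator (B (Suc n)) \<omega>) = p\<^sub>B * expectation \<phi>"
proof -
  let ?I = "UNIV \<times> {1..n} \<union> {(False, Suc n)}"
  have "\<phi> \<in> borel_measurable M"
    by (rule gen_measurable_M[OF _ assms(1)]) auto
  then have int: "integrable M \<phi>"
    using bound by (intro integrable_const_bound[of _ c]) auto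
  have *: "expectation (\<lambda>\<omega>. \<phi> \<omega> * indicator E \<omega>) = prob E * expectation \<phi>"
    if "(indicator E :: 'a \<Rightarrow> real) \<in> borel_measurable (gen {(True, Suc n)})" "E \<in> events" for E
  proof -
    have "indep_var borel \<phi> borel (indicator E)"
      by (rule gen_indep[OF _ _ _ assms(1) that(1)]) auto
    moreover have "integrable M (indicator E :: 'a \<Rightarrow> real)"
      using that(2) by (intro integrable_const_bound[of _ 1]) auto
    ultimately show ?thesis
      using int that(2) by (simp add: indep_var_lebesgue_integral)
  qed
  show "expectation (\<lambda>\<omega>. \<phi> \<omega> * indicator (A (Suc n)) \<omega>) = p\<^sub>A * expectation \<phi>"
    using *[OF gen_A A_event] prob_A by simp
  show "expectation (\<lambda>\<omega>. \<phi> \<omega> * indicator (B (Suc n)) \<omega>) = p\<^sub>B * expectation \<phi>"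
    using *[OF gen_B B_event] prob_B by simp
qed

text \<open>
The four branches of the recursion: arm A is played and wins or loses, arm B is played and wins or loses.
Given the past, A is played with probability \<open>X\<^sub>n\<close>, and the outcomes do not depend on which arm is played.
\<close>
lemma expectation_outcomes:
  assumes \<phi>: "\<phi> \<in> borel_measurable (past n)" and bound: "\<And>\<omega>. \<omega> \<in> space M \<Longrightarrow> \<bar>\<phi> \<omega>\<bar> \<le> c"
  defines "u \<equiv> \<lambda>\<omega>. of_bool (U (Suc n) \<omega> \<le> X n \<omega>)"
  shows "expectation (\<lambda>\<omega>. \<phi> \<omega> * u \<omega> * indicator (A (Suc n)) \<omega>) = p\<^sub>A * expectation (\<lambda>\<omega>. \<phi> \<omega> * X n \<omega>)"
    and "expectation (\<lambda>\<omega>. \<phi> \<omega> * u \<omega> * (1 - indicator (A (Suc n)) \<omega>)) =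
      (1 - p\<^sub>A) * expectation (\<lambda>\<omega>. \<phi> \<omega> * X n \<omega>)"
    and "expectation (\<lambda>\<omega>. \<phi> \<omega> * (1 - u \<omega>) * indicator (B (Suc n)) \<omega>) =
      p\<^sub>B * expectation (\<lambda>\<omega>. \<phi> \<omega> * (1 - X n \<omega>))"
    and "expectation (\<lambda>\<omega>. \<phi> \<omega> * (1 - u \<omega>) * (1 - indicator (B (Suc n)) \<omega>)) =
      (1 - p\<^sub>B) * expectation (\<lambda>\<omega>. \<phi> \<omega> * (1 - X n \<omega>))"
proof -
  let ?a = "indicator (A (Suc n)) :: 'a \<Rightarrow> real" and ?b = "indicator (B (Suc n)) :: 'a \<Rightarrow> real"
  let ?I = "UNIV \<times> {1..n} \<union> {(False, Suc n)}"
  have up: "f \<in> borel_measurable (gen ?I)" if "f \<in> borel_measurable (past n)" for f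
    using that unfolding past_def by (rule gen_measurable_mono[rotated]) auto
  have toM: "f \<in> borel_measurable M" if "f \<in> borel_measurable (gen ?I)" for f
    using that by (rule gen_measurable_M[rotated]) auto
  have [measurable]: "\<phi> \<in> borel_measurable (gen ?I)" "X n \<in> borel_measurable (gen ?I)"
    "U (Suc n) \<in> borel_measurable (gen ?I)"
    by (rule up[OF \<phi>], rule up[OF X_past[OF order_refl]], rule gen_U, simp)
  have u: "u \<in> borel_measurable (gen ?I)"
    unfolding u_def by measurable
  have u01: "0 \<le> u \<omega>" "u \<omega> \<le> 1" for \<omega>
    by (auto simp: u_def)
  have [measurable]: "\<phi> \<in> borel_measurable M" "u \<in> borel_measurable M" "A (Suc n) \<in> events" "B (Suc n) \<in> events"
    using u by (auto intro: toM past_measurable_M[OF \<phi>] A_event B_event)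
  have c: "0 \<le> c"
    using bound not_empty by fastforce
  have prod_bound: "\<bar>\<phi> \<omega> * v * w\<bar> \<le> c" if "\<omega> \<in> space M" "0 \<le> v" "v \<le> 1" "0 \<le> w" "w \<le> 1" for v w \<omega>
  proof -
    have "\<bar>\<phi> \<omega> * v * w\<bar> = \<bar>\<phi> \<omega>\<bar> * (v * w)"
      using that by (simp add: abs_mult)
    also have "\<dots> \<le> c * 1"
      using that bound c by (intro mult_mono mult_le_one) auto
    finally show ?thesis by simp
  qed
  have int: "integrable M (\<lambda>\<omega>. \<phi> \<omega> * v \<omega> * w \<omega>)"
    if "v \<in> borel_measurable M" "w \<in> borel_measurable M" "\<And>\<omega>. \<omega> \<in> space M \<Longrightarrow> v \<omega> \<in> {0..1}"
      "\<And>\<omega>. \<omega> \<in> space M \<Longrightarrow> w \<omega> \<in> {0..1}" for v w :: "'a \<Rightarrow> real"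
    using that prod_bound by (intro integrable_const_bound[of _ c]) auto
  have i1: "integrable M (\<lambda>\<omega>. \<phi> \<omega> * u \<omega>)" "integrable M (\<lambda>\<omega>. \<phi> \<omega> * (1 - u \<omega>))"
    "integrable M \<phi>" "integrable M (\<lambda>\<omega>. \<phi> \<omega> * X n \<omega>)"
    using int[of u "\<lambda>_. 1"] int[of "\<lambda>\<omega>. 1 - u \<omega>" "\<lambda>_. 1"] int[of "\<lambda>_. 1" "\<lambda>_. 1"] int[of "X n" "\<lambda>_. 1"] X_range u01
    by auto
  have i2: "integrable M (\<lambda>\<omega>. \<phi> \<omega> * u \<omega> * ?a \<omega>)" "integrable M (\<lambda>\<omega>. \<phi> \<omega> * (1 - u \<omega>) * ?b \<omega>)"
    using int[of u ?a] int[of "\<lambda>\<omega>. 1 - u \<omega>" ?b] u01 by auto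
  have low: "expectation (\<lambda>\<omega>. \<phi> \<omega> * u \<omega>) = expectation (\<lambda>\<omega>. \<phi> \<omega> * X n \<omega>)"
    unfolding u_def by (rule expectation_draw_below[OF \<phi> bound])
  have up: "expectation (\<lambda>\<omega>. \<phi> \<omega> * (1 - u \<omega>)) = expectation (\<lambda>\<omega>. \<phi> \<omega> * (1 - X n \<omega>))"
    using i1 low by (simp add: right_diff_distrib)
  have gm: "(\<lambda>\<omega>. \<phi> \<omega> * u \<omega>) \<in> borel_measurable (gen ?I)" "(\<lambda>\<omega>. \<phi> \<omega> * (1 - u \<omega>)) \<in> borel_measurable (gen ?I)"
    using u by measurable
  show 1: "expectation (\<lambda>\<omega>. \<phi> \<omega> * u \<omega> * ?a \<omega>) = p\<^sub>A * expectation (\<lambda>\<omega>. \<phi> \<omega> * X n \<omega>)"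
    unfolding low [symmetric]
    by (rule expectation_times_arm(1)[where c = c, OF gm(1)]) (use prod_bound[of _ _ 1] u01 in auto)
  show 2: "expectation (\<lambda>\<omega>. \<phi> \<omega> * (1 - u \<omega>) * ?b \<omega>) = p\<^sub>B * expectation (\<lambda>\<omega>. \<phi> \<omega> * (1 - X n \<omega>))"
    unfolding up [symmetric]
    by (rule expectation_times_arm(2)[where c = c, OF gm(2)]) (use prod_bound[of _ _ 1] u01 in auto)
  show "expectation (\<lambda>\<omega>. \<phi> \<omega> * u \<omega> * (1 - ?a \<omega>)) = (1 - p\<^sub>A) * expectation (\<lambda>\<omega>. \<phi> \<omega> * X n \<omega>)"
  proof -
    have "expectation (\<lambda>\<omega>. \<phi> \<omega> * u \<omega> * (1 - ?a \<omega>)) = expectation (\<lambda>\<omega>. \<phi> \<omega> * u \<omega> - \<phi> \<omega> * u \<omega> * ?a \<omega>)"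
      by (simp add: right_diff_distrib)
    then show ?thesis
      using i1 i2 1 low by (simp add: left_diff_distrib)
  qed
  show "expectation (\<lambda>\<omega>. \<phi> \<omega> * (1 - u \<omega>) * (1 - ?b \<omega>)) = (1 - p\<^sub>B) * expectation (\<lambda>\<omega>. \<phi> \<omega> * (1 - X n \<omega>))"
  proof -
    have "expectation (\<lambda>\<omega>. \<phi> \<omega> * (1 - u \<omega>) * (1 - ?b \<omega>)) =
        expectation (\<lambda>\<omega>. \<phi> \<omega> * (1 - u \<omega>) - \<phi> \<omega> * (1 - u \<omega>) * ?b \<omega>)"
      by (simp add: algebra_simps)
    also have "\<dots> = expectation (\<lambda>\<omega>. \<phi> \<omega> * (1 - u \<omega>)) - expectation (\<lambda>\<omega>. \<phi> \<omega> * (1 - u \<omega>) * ?b \<omega>)"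
      by (rule Bochner_Integration.integral_diff[OF i1(2) i2(2)])
    finally show ?thesis
      unfolding 2 up by (simp add: left_diff_distrib)
  qed
qed

text \<open>
The one-step operator of the Markov chain: the mean of \<open>f (X\<^sub>n)\<close> when \<open>X\<^sub>n\<^sub>-\<^sub>1 = z\<close>.
\<close>
definition transition :: "nat \<Rightarrow> (real \<Rightarrow> real) \<Rightarrow> real \<Rightarrow> real" where
  "transition n f z =
     p\<^sub>A * z * f (z + \<gamma> n * (1 - z)) + (1 - p\<^sub>A) * z * f (z - \<gamma> n * \<rho> n * z)
   + p\<^sub>B * (1 - z) * f (z - \<gamma> n * z) + (1 - p\<^sub>B) * (1 - z) * f (z + \<gamma> n * \<rho> n * (1 - z))"

text \<open>
The Markov property, tested against a function \<open>\<phi>\<close> of the past instead of being stated with a conditional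
expectation.
\<close>
lemma expectation_transition:
  assumes \<phi>: "\<phi> \<in> borel_measurable (past n)" and bound: "\<And>\<omega>. \<omega> \<in> space M \<Longrightarrow> \<bar>\<phi> \<omega>\<bar> \<le> c"
    and f [measurable]: "f \<in> borel_measurable borel" and f_bound: "\<And>z. z \<in> {0..1} \<Longrightarrow> \<bar>f z\<bar> \<le> d"
  shows "expectation (\<lambda>\<omega>. \<phi> \<omega> * f (X (Suc n) \<omega>)) = expectation (\<lambda>\<omega>. \<phi> \<omega> * transition (Suc n) f (X n \<omega>))"
proof -
  let ?g = "\<gamma> (Suc n)" and ?r = "\<gamma> (Suc n) * \<rho> (Suc n)"
  let ?a = "indicator (A (Suc n)) :: 'a \<Rightarrow> real" and ?b = "indicator (B (Suc n)) :: 'a \<Rightarrow> real"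
  let ?u = "\<lambda>\<omega>. of_bool (U (Suc n) \<omega> \<le> X n \<omega>) :: real"
  have [measurable]: "\<phi> \<in> borel_measurable M" "A (Suc n) \<in> events" "B (Suc n) \<in> events" "U (Suc n) \<in> borel_measurable M"
    using \<phi> U_indep by (auto intro: past_measurable_M A_event B_event simp: indep_vars_def2)
  have c: "0 \<le> c"
    using bound not_empty by fastforce
  define k :: "nat \<Rightarrow> real \<Rightarrow> real" where "k i z =
    (if i = 1 then z + ?g * (1 - z) else if i = 2 then z - ?r * z else if i = 3 then z - ?g * z
     else z + ?r * (1 - z))" for i z
  define \<psi> where "\<psi> i \<omega> = \<phi> \<omega> * f (k i (X n \<omega>))" for i \<omega>
  have k [measurable]: "k i \<in> borel_measurable borel" for i
    unfolding k_def by measurable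
  have \<psi>: "\<psi> i \<in> borel_measurable (past n)" for i
    unfolding \<psi>_def using \<phi> X_past[of n n] by simp
  have [measurable]: "\<psi> i \<in> borel_measurable M" for i
    by (rule past_measurable_M[OF \<psi>])
  have k01: "k i z \<in> {0..1}" if z: "z \<in> {0..1}" for i z
    using step_range[of ?g z] step_range[of ?r z] z gamma_pos[of "Suc n"] gamma_less_1[of "Suc n"]
      rho_pos[of "Suc n"] gamma_rho_less_1[of "Suc n"]
    by (simp add: k_def)
  have \<psi>_bound: "\<bar>\<psi> i \<omega>\<bar> \<le> c * d" if "\<omega> \<in> space M" for i \<omega>
    unfolding \<psi>_def abs_mult using that bound f_bound k01 X_range c by (intro mult_mono) auto
  have int: "integrable M (\<lambda>\<omega>. \<psi> i \<omega> * v \<omega>)"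
    if "v \<in> borel_measurable M" "\<And>\<omega>. \<omega> \<in> space M \<Longrightarrow> v \<omega> \<in> {0..1}" for v :: "'a \<Rightarrow> real" and i
  proof (rule integrable_const_bound[of _ "c * d"])
    show "AE \<omega> in M. norm (\<psi> i \<omega> * v \<omega>) \<le> c * d"
    proof (rule AE_I2)
      fix \<omega> assume \<omega>: "\<omega> \<in> space M"
      have "\<bar>\<psi> i \<omega>\<bar> * \<bar>v \<omega>\<bar> \<le> (c * d) * 1"
        using \<psi>_bound[OF \<omega>] that(2)[OF \<omega>] by (intro mult_mono) (auto intro: order_trans[OF abs_ge_zero])
      then show "norm (\<psi> i \<omega> * v \<omega>) \<le> c * d"
        by (simp add: abs_mult)
    qed
  qed (use that(1) in measurable)
  have int': "integrable M (\<lambda>\<omega>. \<psi> i \<omega> * v \<omega> * w \<omega>)"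
    if "v \<in> borel_measurable M" "\<And>\<omega>. v \<omega> \<in> {0..1}" "w \<in> borel_measurable M" "\<And>\<omega>. w \<omega> \<in> {0..1}"
    for v w :: "'a \<Rightarrow> real" and i
    using int[of "\<lambda>\<omega>. v \<omega> * w \<omega>" i] that by (auto simp: mult.assoc intro!: mult_le_one)
  have i: "integrable M (\<lambda>\<omega>. \<psi> 1 \<omega> * ?u \<omega> * ?a \<omega>)" "integrable M (\<lambda>\<omega>. \<psi> 2 \<omega> * ?u \<omega> * (1 - ?a \<omega>))"
    "integrable M (\<lambda>\<omega>. \<psi> 3 \<omega> * (1 - ?u \<omega>) * ?b \<omega>)" "integrable M (\<lambda>\<omega>. \<psi> 4 \<omega> * (1 - ?u \<omega>) * (1 - ?b \<omega>))"
    by (intro int'; simp add: indicator_def)+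
  have j: "integrable M (\<lambda>\<omega>. \<psi> i \<omega> * X n \<omega>)" "integrable M (\<lambda>\<omega>. \<psi> i \<omega> * (1 - X n \<omega>))" for i
    by (intro int; use X_range in simp)+
  have "expectation (\<lambda>\<omega>. \<phi> \<omega> * f (X (Suc n) \<omega>)) = expectation (\<lambda>\<omega>. \<psi> 1 \<omega> * ?u \<omega> * ?a \<omega> + \<psi> 2 \<omega> * ?u \<omega> * (1 - ?a \<omega>)
      + \<psi> 3 \<omega> * (1 - ?u \<omega>) * ?b \<omega> + \<psi> 4 \<omega> * (1 - ?u \<omega>) * (1 - ?b \<omega>))"
    by (rule Bochner_Integration.integral_cong[OF refl]) (simp add: X_Suc_cases \<psi>_def k_def indicator_def)
  also have "\<dots> = p\<^sub>A * expectation (\<lambda>\<omega>. \<psi> 1 \<omega> * X n \<omega>) + (1 - p\<^sub>A) * expectation (\<lambda>\<omega>. \<psi> 2 \<omega> * X n \<omega>)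
      + p\<^sub>B * expectation (\<lambda>\<omega>. \<psi> 3 \<omega> * (1 - X n \<omega>)) + (1 - p\<^sub>B) * expectation (\<lambda>\<omega>. \<psi> 4 \<omega> * (1 - X n \<omega>))"
    by (simp only: i Bochner_Integration.integral_add Bochner_Integration.integrable_add
      expectation_outcomes[OF \<psi> \<psi>_bound])
  also have "\<dots> = expectation (\<lambda>\<omega>. p\<^sub>A * (\<psi> 1 \<omega> * X n \<omega>) + (1 - p\<^sub>A) * (\<psi> 2 \<omega> * X n \<omega>)
      + p\<^sub>B * (\<psi> 3 \<omega> * (1 - X n \<omega>)) + (1 - p\<^sub>B) * (\<psi> 4 \<omega> * (1 - X n \<omega>)))"
    by (simp only: j Bochner_Integration.integral_add Bochner_Integration.integrable_add
      integrable_mult_right integral_mult_right_zero)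
  also have "\<dots> = expectation (\<lambda>\<omega>. \<phi> \<omega> * transition (Suc n) f (X n \<omega>))"
    by (rule Bochner_Integration.integral_cong[OF refl])
      (simp add: transition_def \<psi>_def k_def algebra_simps)
  finally show ?thesis .
qed

section \<open>One step of the exponential moments\<close>

text \<open>
The mean increment of the chain at \<open>z\<close>, divided by the step size \<open>\<gamma> n\<close>.
\<close>
definition drift :: "nat \<Rightarrow> real \<Rightarrow> real" where
  "drift n z = (p\<^sub>A - p\<^sub>B) * z * (1 - z) - \<rho> n * ((1 - p\<^sub>A) * z\<^sup>2 - (1 - p\<^sub>B) * (1 - z)\<^sup>2)"

text \<open>
A Bernstein-type estimate. The factor \<open>z * (1 - z) + (\<rho> n)\<^sup>2\<close> bounds the mean square of the increment divided
by \<open>(\<gamma> n)\<^sup>2\<close>. That it degenerates at \<open>z = 1\<close>, up to the penalty, makes deviations on the scale \<open>\<rho>\<close>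
detectable with \<open>t\<close> of order \<open>1 / \<gamma> n\<close>.
\<close>
lemma transition_exp_le:
  assumes n: "n \<ge> 1" and \<rho>: "\<rho> n \<le> 1" and t: "\<bar>t * \<gamma> n\<bar> \<le> 1" and z: "z \<in> {0..1}"
  shows "transition n (\<lambda>z. exp (t * z)) z \<le>
    exp (t * z + t * \<gamma> n * drift n z + (t * \<gamma> n)\<^sup>2 * (z * (1 - z) + (\<rho> n)\<^sup>2))"
proof -
  let ?s = "t * \<gamma> n" and ?r = "\<rho> n"
  have r: "0 < ?r" using rho_pos n by simp
  have bd: "?s * w \<le> 1" if "\<bar>w\<bar> \<le> 1" for w
  proof -
    have "\<bar>?s * w\<bar> \<le> 1"
      unfolding abs_mult[of ?s w] using t that by (intro mult_le_one) auto
    then show ?thesis by simp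
  qed
  have shift: "exp (t * (z + \<gamma> n * w)) \<le> exp (t * z) * (1 + ?s * w + (?s * w)\<^sup>2)" if "\<bar>w\<bar> \<le> 1" for w
  proof -
    have "exp (t * (z + \<gamma> n * w)) = exp (t * z) * exp (?s * w)"
      by (simp add: exp_add [symmetric] algebra_simps)
    then show ?thesis
      using exp_le_quadratic[OF bd[OF that]] by simp
  qed
  have e1: "exp (t * (z + \<gamma> n * (1 - z))) \<le> exp (t * z) * (1 + ?s * (1 - z) + (?s * (1 - z))\<^sup>2)"
    using shift[of "1 - z"] z by auto
  have e2: "exp (t * (z - \<gamma> n * ?r * z)) \<le> exp (t * z) * (1 + ?s * (- ?r * z) + (?s * (- ?r * z))\<^sup>2)"
    using shift[of "- ?r * z"] z r \<rho> by (simp add: mult_le_one abs_mult mult.assoc)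
  have e3: "exp (t * (z - \<gamma> n * z)) \<le> exp (t * z) * (1 + ?s * (- z) + (?s * (- z))\<^sup>2)"
    using shift[of "- z"] z by simp
  have e4: "exp (t * (z + \<gamma> n * ?r * (1 - z))) \<le> exp (t * z) * (1 + ?s * (?r * (1 - z)) + (?s * (?r * (1 - z)))\<^sup>2)"
    using shift[of "?r * (1 - z)"] z r \<rho> by (simp add: mult_le_one abs_mult mult.assoc)
  \<comment> \<open>The rewards contribute at most \<open>z (1 - z)\<^sup>2 + (1 - z) z\<^sup>2 = z (1 - z)\<close>, the penalties at most \<open>\<rho>\<^sup>2\<close>.\<close>
  have second_moment: "p\<^sub>A * z * (1 - z)\<^sup>2 + (1 - p\<^sub>A) * z * (?r * z)\<^sup>2 + p\<^sub>B * (1 - z) * z\<^sup>2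
      + (1 - p\<^sub>B) * (1 - z) * (?r * (1 - z))\<^sup>2 \<le> z * (1 - z) + ?r\<^sup>2"
  proof -
    have "p\<^sub>A * (z * (1 - z)\<^sup>2) \<le> 1 * (z * (1 - z)\<^sup>2)" "p\<^sub>B * ((1 - z) * z\<^sup>2) \<le> 1 * ((1 - z) * z\<^sup>2)"
      using z p_bounds by (intro mult_right_mono; simp)+
    moreover have "(1 - p\<^sub>A) * z * (?r * z)\<^sup>2 \<le> 1 * z * (?r * 1)\<^sup>2"
      using z p_bounds r by (intro mult_mono power_mono) auto
    moreover have "(1 - p\<^sub>B) * (1 - z) * (?r * (1 - z))\<^sup>2 \<le> 1 * (1 - z) * (?r * 1)\<^sup>2"
      using z p_bounds r by (intro mult_mono power_mono) auto
    moreover have "z * (1 - z)\<^sup>2 + (1 - z) * z\<^sup>2 = z * (1 - z)"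
      by (simp add: power2_eq_square algebra_simps)
    ultimately show ?thesis
      by (simp add: algebra_simps)
  qed
  have "transition n (\<lambda>z. exp (t * z)) z \<le>
      p\<^sub>A * z * (exp (t * z) * (1 + ?s * (1 - z) + (?s * (1 - z))\<^sup>2))
    + (1 - p\<^sub>A) * z * (exp (t * z) * (1 + ?s * (- ?r * z) + (?s * (- ?r * z))\<^sup>2))
    + p\<^sub>B * (1 - z) * (exp (t * z) * (1 + ?s * (- z) + (?s * (- z))\<^sup>2))
    + (1 - p\<^sub>B) * (1 - z) * (exp (t * z) * (1 + ?s * (?r * (1 - z)) + (?s * (?r * (1 - z)))\<^sup>2))"
    unfolding transition_def using z p_bounds
    by (intro add_mono mult_left_mono e1 e2 e3 e4) auto
  also have "\<dots> = exp (t * z) * (1 + ?s * drift n z + ?s\<^sup>2 *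
      (p\<^sub>A * z * (1 - z)\<^sup>2 + (1 - p\<^sub>A) * z * (?r * z)\<^sup>2 + p\<^sub>B * (1 - z) * z\<^sup>2
      + (1 - p\<^sub>B) * (1 - z) * (?r * (1 - z))\<^sup>2))"
    unfolding drift_def by algebra
  also have "\<dots> \<le> exp (t * z) * (1 + (?s * drift n z + ?s\<^sup>2 * (z * (1 - z) + ?r\<^sup>2)))"
    using mult_left_mono[OF second_moment, of "?s\<^sup>2"] by simp
  also have "\<dots> \<le> exp (t * z) * exp (?s * drift n z + ?s\<^sup>2 * (z * (1 - z) + ?r\<^sup>2))"
    by (intro mult_left_mono exp_ge_add_one_self) simp
  finally show ?thesis
    by (simp add: exp_add)
qed

lemma integrable_bounded:
  "f \<in> borel_measurable M \<Longrightarrow> (\<And>\<omega>. \<omega> \<in> space M \<Longrightarrow> \<bar>f \<omega>\<bar> \<le> c) \<Longrightarrow> integrable M f" for f :: "'a \<Rightarrow> real"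
  by (rule integrable_const_bound[of _ c]) auto

lemma exp_X_bound: "\<omega> \<in> space M \<Longrightarrow> exp (t * X n \<omega>) \<le> exp \<bar>t\<bar>"
  using X_range[of \<omega> n] mult_mono[of t "\<bar>t\<bar>" "X n \<omega>" 1] by simp

lemma integrable_exp_X:
  assumes "G \<in> events"
  shows "integrable M (\<lambda>\<omega>. indicator G \<omega> * exp (t * X n \<omega>))"
  using assms exp_X_bound
  by (intro integrable_bounded[of _ "exp \<bar>t\<bar>"]) (auto simp: indicator_def)

text \<open>
The form in which the estimate is applied: it suffices to bound the exponent pointwise on an event \<open>G\<close> of the
past.
\<close>
lemma expectation_exp_step:
  assumes n: "n \<ge> 1" and \<rho>: "\<rho> (Suc n) \<le> 1" and t: "\<bar>t * \<gamma> (Suc n)\<bar> \<le> 1" and G: "G \<in> sets (past n)"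
    and H: "\<And>\<omega>. \<omega> \<in> G \<Longrightarrow> t * X n \<omega> + t * \<gamma> (Suc n) * drift (Suc n) (X n \<omega>)
      + (t * \<gamma> (Suc n))\<^sup>2 * (X n \<omega> * (1 - X n \<omega>) + (\<rho> (Suc n))\<^sup>2) \<le> H \<omega>"
    and int: "integrable M (\<lambda>\<omega>. indicator G \<omega> * exp (H \<omega>))"
  shows "expectation (\<lambda>\<omega>. indicator G \<omega> * exp (t * X (Suc n) \<omega>)) \<le> expectation (\<lambda>\<omega>. indicator G \<omega> * exp (H \<omega>))"
proof -
  have "expectation (\<lambda>\<omega>. indicator G \<omega> * exp (t * X (Suc n) \<omega>)) =
      expectation (\<lambda>\<omega>. indicator G \<omega> * transition (Suc n) (\<lambda>z. exp (t * z)) (X n \<omega>))"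
  proof (rule expectation_transition[of _ _ 1 _ "exp \<bar>t\<bar>"])
    show "\<bar>exp (t * z)\<bar> \<le> exp \<bar>t\<bar>" if "z \<in> {0..1}" for z
      using that mult_mono[of t "\<bar>t\<bar>" z 1] by simp
  qed (use G in \<open>auto simp: indicator_def\<close>)
  also have "\<dots> \<le> expectation (\<lambda>\<omega>. indicator G \<omega> * exp (H \<omega>))"
  proof (rule integral_mono_AE'[OF int])
    have G_sp: "G \<subseteq> space M"
      using sets.sets_into_space[OF G] by simp
    show "AE \<omega> in M. indicator G \<omega> * transition (Suc n) (\<lambda>z. exp (t * z)) (X n \<omega>) \<le> indicator G \<omega> * exp (H \<omega>)"
    proof (rule AE_I2)
      fix \<omega> assume \<omega>: "\<omega> \<in> space M"
      show "indicator G \<omega> * transition (Suc n) (\<lambda>z. exp (t * z)) (X n \<omega>) \<le> indicator G \<omega> * exp (H \<omega>)"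
      proof (cases "\<omega> \<in> G")
        case True
        have "transition (Suc n) (\<lambda>z. exp (t * z)) (X n \<omega>) \<le> exp (H \<omega>)"
          by (rule order_trans[OF transition_exp_le]) (use \<rho> t X_range[OF \<omega>] H[OF True] in auto)
        then show ?thesis using True by simp
      qed simp
    qed
    show "AE \<omega> in M. 0 \<le> indicator G \<omega> * exp (H \<omega>)" by simp
  qed
  finally show ?thesis .
qed

section \<open>The trajectory exceeds every level below 1\<close>

lemma gamma_antimono: "1 \<le> m \<Longrightarrow> m \<le> n \<Longrightarrow> \<gamma> n \<le> \<gamma> m"
proof (induction n rule: nat_induct)
  case (Suc n)
  then show ?case
    using gamma_decreasing[of n] by (cases "m = Suc n") auto
qed simp

lemma transition_complement: "transition n (\<lambda>z. 1 - z) z = 1 - z - \<gamma> n * drift n z"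
  by (simp add: transition_def drift_def algebra_simps power2_eq_square)

text \<open>
Decreasing in \<open>k\<close> and known at time \<open>k\<close>: restricting expectations to these events does the work of stopping
the process when it first leaves \<open>S\<close>.
\<close>
definition staying :: "nat \<Rightarrow> nat \<Rightarrow> real set \<Rightarrow> 'a set" where
  "staying N k S = {\<omega> \<in> space M. \<forall>j\<in>{N..k}. X j \<omega> \<in> S}"

lemma staying_past:
  assumes "S \<in> sets borel"
  shows "staying N k S \<in> sets (past k)"
proof -
  have "{\<omega> \<in> space (past k). \<forall>j\<in>{N..k}. X j \<omega> \<in> S} \<in> sets (past k)"
  proof (rule sets.sets_Collect_finite_All)
    fix j assume "j \<in> {N..k}"
    then have "X j \<in> borel_measurable (past k)"
      by (intro X_past) simp
    then have "X j -` S \<inter> space (past k) \<in> sets (past k)"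
      using assms by (rule measurable_sets)
    moreover have "{\<omega> \<in> space (past k). X j \<omega> \<in> S} = X j -` S \<inter> space (past k)"
      by auto
    ultimately show "{\<omega> \<in> space (past k). X j \<omega> \<in> S} \<in> sets (past k)"
      by simp
  qed simp
  then show ?thesis
    by (simp add: staying_def)
qed

lemma staying_event: "S \<in> sets borel \<Longrightarrow> staying N k S \<in> events"
  by (rule past_event[OF staying_past])

lemma staying_Suc_subset: "staying N (Suc k) S \<subseteq> staying N k S"
  by (auto simp: staying_def)

text \<open>
Let \<open>E\<close> be the event that \<open>X\<close> stays below \<open>u\<close> from time \<open>N\<close> on. At each step the mean of \<open>1 - X\<close>,
restricted to not having exceeded \<open>u\<close> yet, decreases by at least \<open>c \<rho> \<gamma>\<close> times the probability of \<open>E\<close>.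
It starts at a value at most \<open>1\<close> and stays nonnegative while \<open>\<Sum>\<rho> \<gamma>\<close> diverges, so \<open>E\<close> is a null set.
\<close>
lemma AE_exceeds_once:
  assumes sum: "filterlim (\<lambda>N. \<Sum>n=1..N. \<rho> n * \<gamma> n) at_top sequentially"
    and c: "0 < c" and drift: "\<And>n z. N \<le> n \<Longrightarrow> z \<in> {0..u} \<Longrightarrow> c * \<rho> (Suc n) \<le> drift (Suc n) z"
  shows "AE \<omega> in M. \<exists>k\<ge>N. u < X k \<omega>"
proof -
  define G where "G k = staying N k {..u}" for k
  have Gpast: "G k \<in> sets (past k)" and G: "G k \<in> events" for k
    by (simp_all add: G_def staying_past staying_event)
  define T where "T m = (\<Sum>n=1..m. \<rho> n * \<gamma> n)" for m
  define E where "E = (\<Inter>k. G k)"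
  have E: "E \<in> events" using G by (auto simp: E_def)
  define b where "b k = expectation (\<lambda>\<omega>. indicator (G k) \<omega> * (1 - X k \<omega>))" for k
  have int: "integrable M (\<lambda>\<omega>. indicator (G k) \<omega> * (1 - X m \<omega>))" for k m
    using G[of k] X_range by (intro integrable_bounded[of _ 1]) (auto simp: indicator_def)
  have decr: "b (Suc m) + c * prob E * (\<rho> (Suc m) * \<gamma> (Suc m)) \<le> b m" if m: "N \<le> m" for m
  proof -
    let ?h = "\<lambda>\<omega>. indicator (G m) \<omega> * (1 - X m \<omega>) - c * \<rho> (Suc m) * \<gamma> (Suc m) * indicator (G m) \<omega>"
    have i: "integrable M (\<lambda>\<omega>. c * \<rho> (Suc m) * \<gamma> (Suc m) * indicator (G m) \<omega>)"
      using G[of m] by (intro integrable_mult_right integrable_bounded[of _ 1]) (auto simp: indicator_def)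
    have "b (Suc m) \<le> expectation (\<lambda>\<omega>. indicator (G m) \<omega> * (1 - X (Suc m) \<omega>))"
      unfolding b_def
      by (rule integral_mono[OF int int], rule mult_right_mono)
        (use staying_Suc_subset X_range in \<open>auto simp: indicator_def G_def\<close>)
    also have "\<dots> = expectation (\<lambda>\<omega>. indicator (G m) \<omega> * transition (Suc m) (\<lambda>z. 1 - z) (X m \<omega>))"
      by (rule expectation_transition[of _ _ 1 _ 1]) (use Gpast in \<open>auto simp: indicator_def\<close>)
    also have "\<dots> \<le> expectation ?h"
    proof (rule integral_mono)
      have [measurable]: "(\<lambda>\<omega>. drift (Suc m) (X m \<omega>)) \<in> borel_measurable M"
        unfolding drift_def by measurable
      have "integrable M (\<lambda>\<omega>. indicator (G m) \<omega> * transition (Suc m) (\<lambda>z. 1 - z) (X m \<omega>))"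
      proof (rule integrable_bounded[of _ 1])
        fix \<omega> assume \<omega>: "\<omega> \<in> space M"
        let ?z = "X m \<omega>" and ?g = "\<gamma> (Suc m)" and ?r = "\<gamma> (Suc m) * \<rho> (Suc m)"
        have gr: "?g \<in> {0..1}" "?r \<in> {0..1}"
          using gamma_pos[of "Suc m"] gamma_less_1[of "Suc m"] rho_pos[of "Suc m"] gamma_rho_less_1[of "Suc m"]
          by auto
        have w: "0 \<le> p * (1 - w)" "p * (1 - w) \<le> p" if "0 \<le> p" "w \<in> {0..1}" for p w :: real
          using that by (auto simp: mult_left_le)
        have z: "?z \<in> {0..1}" using X_range[OF \<omega>] .
        have p: "0 \<le> p\<^sub>A * ?z" "0 \<le> (1 - p\<^sub>A) * ?z" "0 \<le> p\<^sub>B * (1 - ?z)" "0 \<le> (1 - p\<^sub>B) * (1 - ?z)"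
          using p_bounds z by auto
        have "0 \<le> transition (Suc m) (\<lambda>z. 1 - z) ?z"
          unfolding transition_def by (intro add_nonneg_nonneg w p step_range gr z)
        moreover have "transition (Suc m) (\<lambda>z. 1 - z) ?z \<le> p\<^sub>A * ?z + (1 - p\<^sub>A) * ?z + p\<^sub>B * (1 - ?z) + (1 - p\<^sub>B) * (1 - ?z)"
          unfolding transition_def by (intro add_mono w p step_range gr z)
        ultimately show "\<bar>indicator (G m) \<omega> * transition (Suc m) (\<lambda>z. 1 - z) (X m \<omega>)\<bar> \<le> 1"
          by (simp add: algebra_simps indicator_def)
      qed (use G[of m] in \<open>unfold transition_complement, measurable\<close>)
      then show "integrable M (\<lambda>\<omega>. indicator (G m) \<omega> * transition (Suc m) (\<lambda>z. 1 - z) (X m \<omega>))" .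
      show "integrable M ?h"
        by (intro Bochner_Integration.integrable_diff int i)
      fix \<omega> assume "\<omega> \<in> space M"
      then have "\<omega> \<in> G m \<Longrightarrow> X m \<omega> \<in> {0..u}"
        using X_range m by (auto simp: G_def staying_def)
      then have "\<omega> \<in> G m \<Longrightarrow> \<gamma> (Suc m) * (c * \<rho> (Suc m)) \<le> \<gamma> (Suc m) * drift (Suc m) (X m \<omega>)"
        using drift[OF m] gamma_pos[of "Suc m"] by (intro mult_left_mono) auto
      then show "indicator (G m) \<omega> * transition (Suc m) (\<lambda>z. 1 - z) (X m \<omega>) \<le> ?h \<omega>"
        by (auto simp: transition_complement indicator_def algebra_simps)
    qed
    also have "\<dots> = b m - c * \<rho> (Suc m) * \<gamma> (Suc m) * prob (G m)"
      unfolding b_def using G[of m] sets.sets_into_space[OF G[of m]] int i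
      by (subst Bochner_Integration.integral_diff) (auto simp: Int_absorb2)
    also have "\<dots> \<le> b m - c * \<rho> (Suc m) * \<gamma> (Suc m) * prob E"
      using c rho_pos[of "Suc m"] gamma_pos[of "Suc m"] E G
      by (intro diff_left_mono mult_left_mono finite_measure_mono) (auto simp: E_def)
    finally show ?thesis by (simp add: algebra_simps)
  qed
  have total: "b m + c * prob E * (T m - T N) \<le> b N" if "N \<le> m" for m
    using that
  proof (induction m rule: dec_induct)
    case (step m)
    have "T (Suc m) = T m + \<rho> (Suc m) * \<gamma> (Suc m)" by (simp add: T_def)
    then show ?case
      using step.IH decr[OF step.hyps(1)] by (simp add: algebra_simps)
  qed simp
  have "prob E = 0"
  proof (rule ccontr)
    assume "prob E \<noteq> 0"
    then have p: "0 < c * prob E"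
      using c by (simp add: zero_less_measure_iff)
    have "eventually (\<lambda>m. T N + (b N + 1) / (c * prob E) \<le> T m) sequentially"
      using sum unfolding T_def filterlim_at_top by blast
    then obtain m where m: "N \<le> m" "T N + (b N + 1) / (c * prob E) \<le> T m"
      using eventually_happens[OF eventually_conj[OF eventually_ge_at_top[of N]]] by auto
    have "b N + 1 \<le> c * prob E * (T m - T N)"
      using m(2) pos_divide_le_eq[OF p, of "b N + 1" "T m - T N"] by (simp add: mult.commute)
    moreover have "0 \<le> b m"
      unfolding b_def using X_range by (intro integral_nonneg_AE AE_I2) (auto simp: indicator_def)
    ultimately show False
      using total[OF m(1)] by simp
  qed
  then have "AE \<omega> in M. \<omega> \<notin> E"
    using E by (intro AE_not_in) (simp add: null_sets_def emeasure_eq_measure)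
  then show ?thesis
    by (rule AE_mp, intro AE_I2) (force simp: E_def G_def staying_def not_less)
qed

section \<open>Downcrossings and convergence to 1\<close>

text \<open>
By time \<open>m\<close> the trajectory has gone from above \<open>u\<close> to below \<open>l\<close>, where \<open>n\<close> is the last time above \<open>u\<close>
before the descent. Fixing \<open>n\<close> makes the probability summable over all possible starting times.
\<close>
definition crossing :: "real \<Rightarrow> real \<Rightarrow> nat \<Rightarrow> nat \<Rightarrow> 'a set" where
  "crossing l u n m = {\<omega> \<in> space M. u < X n \<omega> \<and>
     (\<exists>k\<in>{n<..m}. (\<forall>j\<in>{n<..<k}. X j \<omega> \<in> {l..u}) \<and> X k \<omega> < l)}"

lemma crossing_event: "crossing l u n m \<in> events"
  unfolding crossing_def by measurable

lemma crossing_Suc: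
  "n \<le> m \<Longrightarrow> crossing l u n (Suc m) =
     crossing l u n m \<union> {\<omega> \<in> space M. u < X n \<omega> \<and> (\<forall>j\<in>{n<..m}. X j \<omega> \<in> {l..u}) \<and> X (Suc m) \<omega> < l}"
proof -
  assume "n \<le> m"
  then have "{n<..Suc m} = insert (Suc m) {n<..m}" "{n<..<Suc m} = {n<..m}"
    by auto
  then show ?thesis
    by (auto simp: crossing_def simp del: greaterThanLessThan_iff greaterThanAtMost_iff)
qed

text \<open>
With the fixed exponent \<open>\<kappa> = \<theta> / \<gamma> n\<close>, the hypothesis on the drift makes \<open>exp (- \<kappa> X)\<close> a supermartingale
while \<open>X\<close> is in \<open>{l..u}\<close>; here it matters that the step sizes decrease, so that \<open>\<kappa> \<gamma> \<le> \<theta>\<close> at all later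
times. The supermartingale starts at about \<open>exp (- \<kappa> u)\<close> and is at least \<open>exp (- \<kappa> l)\<close> upon a crossing.
The factor \<open>exp \<theta>\<close> accounts for the first step down from above \<open>u\<close>.
\<close>
lemma prob_crossing_le:
  assumes n: "1 \<le> n" and \<theta>: "0 < \<theta>" "\<theta> \<le> 1" and lu: "l < u"
    and \<rho>: "\<And>m. n \<le> m \<Longrightarrow> \<rho> (Suc m) \<le> 1"
    and drift: "\<And>m z. n \<le> m \<Longrightarrow> z \<in> {0..u} \<Longrightarrow>
      \<theta> * (z * (1 - z) + (\<rho> (Suc m))\<^sup>2) \<le> drift (Suc m) z"
    and m: "n \<le> m"
  shows "prob (crossing l u n m) \<le> exp \<theta> * exp (- (\<theta> * (u - l)) / \<gamma> n)"
proof -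
  define \<kappa> where "\<kappa> = \<theta> / \<gamma> n"
  have \<gamma>n: "0 < \<gamma> n" using gamma_pos n by simp
  have \<kappa>: "0 < \<kappa>" "\<kappa> * \<gamma> n = \<theta>"
    using \<theta> \<gamma>n by (simp_all add: \<kappa>_def)
  have s: "0 \<le> \<kappa> * \<gamma> (Suc m)" "\<kappa> * \<gamma> (Suc m) \<le> \<theta>" if "n \<le> m" for m
  proof -
    show "0 \<le> \<kappa> * \<gamma> (Suc m)" using \<kappa> gamma_pos[of "Suc m"] by simp
    have "\<kappa> * \<gamma> (Suc m) \<le> \<kappa> * \<gamma> n"
      using \<kappa> gamma_antimono[of n "Suc m"] n that by (intro mult_left_mono) auto
    then show "\<kappa> * \<gamma> (Suc m) \<le> \<theta>" using \<kappa> by simp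
  qed
  define Q where "Q m = {\<omega> \<in> space M. u < X n \<omega>} \<inter> staying (Suc n) m {l..u}" for m
  have Qn: "{\<omega> \<in> space M. u < X n \<omega>} \<in> sets (past m)" if "n \<le> m" for m
  proof -
    have "X n -` {u<..} \<inter> space (past m) \<in> sets (past m)"
      by (rule measurable_sets[OF X_past[OF that]]) simp
    moreover have "{\<omega> \<in> space M. u < X n \<omega>} = X n -` {u<..} \<inter> space (past m)"
      by auto
    ultimately show ?thesis by simp
  qed
  have Qpast: "Q m \<in> sets (past m)" if "n \<le> m" for m
    unfolding Q_def by (intro sets.Int Qn staying_past that) simp
  have Q: "Q m \<in> events" if "n \<le> m" for m
    using past_event[OF Qpast[OF that]] .
  have C: "crossing l u n m \<in> events" for m by (rule crossing_event)
  have int: "integrable M (\<lambda>\<omega>. indicator (Q m) \<omega> * exp (- \<kappa> * X k \<omega>))" if "n \<le> m" for m k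
    by (rule integrable_exp_X[OF Q[OF that]])
  have intC: "integrable M (\<lambda>\<omega>. exp (- \<kappa> * l) * indicator (crossing l u n m) \<omega>)" for m
    using C by (intro integrable_bounded[of _ "exp (- \<kappa> * l)"]) (auto simp: indicator_def)
  have expC: "expectation (\<lambda>\<omega>. exp (- \<kappa> * l) * indicator (crossing l u n m) \<omega>) = exp (- \<kappa> * l) * prob (crossing l u n m)" for m
    using C[of m] sets.sets_into_space[OF C[of m]] by (simp add: Int_absorb2)
  \<comment> \<open>Mass leaving \<open>{l..u}\<close> at the bottom is collected in the second summand, mass leaving at the top is dropped.\<close>
  have exit: "expectation (\<lambda>\<omega>. indicator (Q (Suc m)) \<omega> * exp (- \<kappa> * X (Suc m) \<omega>)) + exp (- \<kappa> * l) * prob (crossing l u n (Suc m))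
      \<le> expectation (\<lambda>\<omega>. indicator (Q m) \<omega> * exp (- \<kappa> * X (Suc m) \<omega>)) + exp (- \<kappa> * l) * prob (crossing l u n m)"
    if m: "n \<le> m" for m
  proof -
    have "expectation (\<lambda>\<omega>. indicator (Q (Suc m)) \<omega> * exp (- \<kappa> * X (Suc m) \<omega>) + exp (- \<kappa> * l) * indicator (crossing l u n (Suc m)) \<omega>)
      \<le> expectation (\<lambda>\<omega>. indicator (Q m) \<omega> * exp (- \<kappa> * X (Suc m) \<omega>) + exp (- \<kappa> * l) * indicator (crossing l u n m) \<omega>)"
    proof (rule integral_mono)
      fix \<omega> assume \<omega>: "\<omega> \<in> space M"
      have below: "X (Suc m) \<omega> < l \<Longrightarrow> exp (- \<kappa> * l) \<le> exp (- \<kappa> * X (Suc m) \<omega>)"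
        using \<kappa> by simp
      have sub: "\<omega> \<in> Q (Suc m) \<Longrightarrow> \<omega> \<in> Q m \<and> \<not> X (Suc m) \<omega> < l"
        using m by (force simp: Q_def staying_def)
      have cr: "\<omega> \<in> crossing l u n (Suc m) \<longleftrightarrow> \<omega> \<in> crossing l u n m \<or> (\<omega> \<in> Q m \<and> X (Suc m) \<omega> < l)"
        using \<omega> m by (auto simp: crossing_Suc Q_def staying_def Suc_le_eq)
      show "indicator (Q (Suc m)) \<omega> * exp (- \<kappa> * X (Suc m) \<omega>) + exp (- \<kappa> * l) * indicator (crossing l u n (Suc m)) \<omega>
        \<le> indicator (Q m) \<omega> * exp (- \<kappa> * X (Suc m) \<omega>) + exp (- \<kappa> * l) * indicator (crossing l u n m) \<omega>"
        using below sub cr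
        by (cases "\<omega> \<in> Q (Suc m)"; cases "\<omega> \<in> Q m"; cases "\<omega> \<in> crossing l u n m"; cases "X (Suc m) \<omega> < l")
          (auto simp: indicator_def)
    qed (use m in \<open>intro Bochner_Integration.integrable_add int intC; simp\<close>)+
    then show ?thesis
      using m by (simp only: Bochner_Integration.integral_add int intC expC le_SucI)
  qed
  have decr: "expectation (\<lambda>\<omega>. indicator (Q m) \<omega> * exp (- \<kappa> * X (Suc m) \<omega>)) \<le> expectation (\<lambda>\<omega>. indicator (Q m) \<omega> * exp (- \<kappa> * X m \<omega>))"
    if m: "n < m" for m
  proof (rule expectation_exp_step)
    let ?s = "\<kappa> * \<gamma> (Suc m)"
    have nm: "n \<le> m" using m by simp
    show "\<bar>- \<kappa> * \<gamma> (Suc m)\<bar> \<le> 1"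
      using s[OF nm] \<theta> by simp
    show "1 \<le> m" "\<rho> (Suc m) \<le> 1" "Q m \<in> sets (past m)"
      using m n \<rho> Qpast by simp_all
    show "integrable M (\<lambda>\<omega>. indicator (Q m) \<omega> * exp (- \<kappa> * X m \<omega>))"
      by (rule int[OF nm])
    fix \<omega> assume \<omega>: "\<omega> \<in> Q m"
    let ?z = "X m \<omega>"
    have z: "?z \<in> {0..1}" "?z \<in> {0..u}"
      using \<omega> m X_range[of \<omega> m] by (auto simp: Q_def staying_def Suc_le_eq)
    have "?s * (?z * (1 - ?z) + (\<rho> (Suc m))\<^sup>2) \<le> \<theta> * (?z * (1 - ?z) + (\<rho> (Suc m))\<^sup>2)"
      using z s[OF nm] by (intro mult_right_mono add_nonneg_nonneg) auto
    also have "\<dots> \<le> drift (Suc m) ?z"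
      by (rule drift[OF nm z(2)])
    finally have "?s * (?s * (?z * (1 - ?z) + (\<rho> (Suc m))\<^sup>2)) \<le> ?s * drift (Suc m) ?z"
      using s[OF nm] by (intro mult_left_mono)
    then show "- \<kappa> * ?z + - \<kappa> * \<gamma> (Suc m) * drift (Suc m) ?z
        + (- \<kappa> * \<gamma> (Suc m))\<^sup>2 * (?z * (1 - ?z) + (\<rho> (Suc m))\<^sup>2) \<le> - \<kappa> * ?z"
      by (simp add: power2_eq_square mult.assoc)
  qed
  have first: "expectation (\<lambda>\<omega>. indicator (Q n) \<omega> * exp (- \<kappa> * X (Suc n) \<omega>)) \<le> exp (\<theta> - \<kappa> * u)"
  proof -
    have "expectation (\<lambda>\<omega>. indicator (Q n) \<omega> * exp (- \<kappa> * X (Suc n) \<omega>)) \<le> expectation (\<lambda>_. exp (\<theta> - \<kappa> * u))"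
    proof (rule integral_mono[OF int])
      fix \<omega> assume \<omega>: "\<omega> \<in> space M"
      have g: "0 < \<gamma> (Suc n)" using gamma_pos by simp
      have z: "0 \<le> X n \<omega>" "X n \<omega> \<le> 1" using X_range[OF \<omega>, of n] by auto
      have "\<gamma> (Suc n) * \<rho> (Suc n) * X n \<omega> \<le> \<gamma> (Suc n)" "\<gamma> (Suc n) * X n \<omega> \<le> \<gamma> (Suc n)"
        using z g \<rho>[of n] rho_pos[of "Suc n"] by (auto simp: mult.assoc intro!: mult_left_le mult_le_one)
      moreover have "0 \<le> \<gamma> (Suc n) * (1 - X n \<omega>)" "0 \<le> \<gamma> (Suc n) * \<rho> (Suc n) * (1 - X n \<omega>)"
        using z g rho_pos[of "Suc n"] by simp_all
      ultimately have "X n \<omega> - \<gamma> (Suc n) \<le> X (Suc n) \<omega>"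
        using g by (simp only: X_Suc_cases[OF \<omega>] split: if_split) (intro conjI impI; linarith)
      moreover have "\<gamma> (Suc n) \<le> \<gamma> n"
        using gamma_decreasing n by simp
      ultimately have "\<omega> \<in> Q n \<Longrightarrow> \<kappa> * (u - \<gamma> n) \<le> \<kappa> * X (Suc n) \<omega>"
        using \<kappa> by (intro mult_left_mono) (auto simp: Q_def)
      then have "\<omega> \<in> Q n \<Longrightarrow> - \<kappa> * X (Suc n) \<omega> \<le> \<theta> - \<kappa> * u"
        using \<kappa> by (simp add: algebra_simps)
      then show "indicator (Q n) \<omega> * exp (- \<kappa> * X (Suc n) \<omega>) \<le> exp (\<theta> - \<kappa> * u)"
        by (simp add: indicator_def)
    qed simp_all
    then show ?thesis by (simp add: prob_space)
  qed
  have C0: "prob (crossing l u n n) = 0"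
    by (simp add: crossing_def)
  have main: "expectation (\<lambda>\<omega>. indicator (Q m) \<omega> * exp (- \<kappa> * X m \<omega>)) + exp (- \<kappa> * l) * prob (crossing l u n m) \<le> exp (\<theta> - \<kappa> * u)"
    if "Suc n \<le> m" for m
    using that
  proof (induction m rule: dec_induct)
    case base
    then show ?case using exit[of n] first C0 by simp
  next
    case (step m)
    then show ?case using exit[of m] decr[of m] by simp
  qed
  show ?thesis
  proof (cases "m = n")
    case True
    then show ?thesis using C0 by simp
  next
    case False
    then have "Suc n \<le> m" using m by simp
    have "0 \<le> expectation (\<lambda>\<omega>. indicator (Q m) \<omega> * exp (- \<kappa> * X m \<omega>))"
      by (rule integral_nonneg_AE) simp
    with main[OF \<open>Suc n \<le> m\<close>] have "exp (- \<kappa> * l) * prob (crossing l u n m) \<le> exp (\<theta> - \<kappa> * u)"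
      by linarith
    then have "exp (\<kappa> * l) * (exp (- \<kappa> * l) * prob (crossing l u n m)) \<le> exp (\<kappa> * l) * exp (\<theta> - \<kappa> * u)"
      by (intro mult_left_mono) auto
    then have "prob (crossing l u n m) \<le> exp (\<kappa> * l + (\<theta> - \<kappa> * u))"
      by (simp add: mult.assoc [symmetric] exp_add [symmetric])
    also have "\<kappa> * l + (\<theta> - \<kappa> * u) = \<theta> + - (\<theta> * (u - l)) / \<gamma> n"
      using \<gamma>n by (simp add: \<kappa>_def field_simps)
    finally show ?thesis by (simp only: exp_add)
  qed
qed

text \<open>
Away from \<open>1\<close> the term \<open>(p\<^sub>A - p\<^sub>B) z (1 - z)\<close> dominates the penalty \<open>\<rho> (1 - p\<^sub>A) z\<^sup>2\<close>, since both vanish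
at \<open>z = 0\<close> and \<open>\<rho>\<close> is small. At \<open>z = 0\<close> what remains is the penalty of arm B, of order \<open>\<rho>\<close>, which
dominates \<open>\<rho>\<^sup>2\<close>.
\<close>
lemma drift_lower_bound:
  assumes \<rho>: "\<rho> \<longlonglongrightarrow> 0" and \<delta>: "0 < \<delta>" "\<delta> < 1"
  obtains c where "0 < c"
    "eventually (\<lambda>n. \<forall>z\<in>{0..1 - \<delta>}. (p\<^sub>A - p\<^sub>B) / 2 * (z * (1 - z) + (\<rho> n)\<^sup>2) + c * \<rho> n \<le> drift n z) sequentially"
proof
  let ?\<pi> = "p\<^sub>A - p\<^sub>B" and ?r = "1 - p\<^sub>B"
  let ?c = "?r * \<delta>\<^sup>2 / 2"
  have \<pi>: "0 < ?\<pi>" "?\<pi> \<le> 1" and r: "0 < ?r"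
    using p_bounds by auto
  show c: "0 < ?c" using r \<delta> by simp
  have "eventually (\<lambda>n. \<rho> n < ?\<pi> * \<delta> / 2) sequentially" "eventually (\<lambda>n. \<rho> n < ?r * \<delta>\<^sup>2) sequentially"
    using \<pi> r \<delta> by (intro order_tendstoD(2)[OF \<rho>]; simp)+
  moreover have "eventually (\<lambda>n::nat. 1 \<le> n) sequentially"
    by (rule eventually_ge_at_top)
  ultimately show "eventually (\<lambda>n. \<forall>z\<in>{0..1 - \<delta>}. ?\<pi> / 2 * (z * (1 - z) + (\<rho> n)\<^sup>2) + ?c * \<rho> n \<le> drift n z) sequentially"
  proof eventually_elim
    case (elim n)
    show ?case
    proof
      fix z assume z: "z \<in> {0..1 - \<delta>}"
      have pos: "0 < \<rho> n" using rho_pos elim by simp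
      define P R\<^sub>1 R\<^sub>2 R\<^sub>3 where "P = ?\<pi> / 2 * (1 - z) * z" and "R\<^sub>1 = \<rho> n * ((1 - p\<^sub>A) * z\<^sup>2)"
        and "R\<^sub>2 = \<rho> n * (?r * (1 - z)\<^sup>2)" and "R\<^sub>3 = ?\<pi> / 2 * (\<rho> n)\<^sup>2"
      note defs = P_def R\<^sub>1_def R\<^sub>2_def R\<^sub>3_def
      have "?\<pi> / 2 * \<delta> * z \<le> P"
        unfolding defs using z \<pi> by (intro mult_right_mono mult_left_mono) auto
      moreover have "R\<^sub>1 \<le> (?\<pi> * \<delta> / 2) * (1 * z)"
        unfolding defs using z elim pos p_bounds \<delta> by (intro mult_mono) (auto simp: power2_eq_square mult_left_le)
      moreover have "(?\<pi> * \<delta> / 2) * (1 * z) = ?\<pi> / 2 * \<delta> * z"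
        by simp
      moreover have "2 * (?c * \<rho> n) \<le> R\<^sub>2"
      proof -
        have "\<rho> n * (?r * \<delta>\<^sup>2) \<le> R\<^sub>2"
          unfolding defs using z pos r \<delta> by (intro mult_left_mono power_mono) auto
        then show ?thesis by (simp add: mult.commute)
      qed
      moreover have "R\<^sub>3 \<le> ?c * \<rho> n"
      proof -
        have "?\<pi> / 2 * (\<rho> n * \<rho> n) \<le> 1 / 2 * (?r * \<delta>\<^sup>2 * \<rho> n)"
          using elim pos \<pi> by (intro mult_mono) auto
        then show ?thesis by (simp add: defs power2_eq_square)
      qed
      moreover have "2 * P = ?\<pi> * z * (1 - z)"
        by (simp add: P_def)
      moreover have "drift n z = ?\<pi> * z * (1 - z) - R\<^sub>1 + R\<^sub>2"
        unfolding drift_def R\<^sub>1_def R\<^sub>2_def by (simp add: right_diff_distrib)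
      moreover have "?\<pi> / 2 * (z * (1 - z) + (\<rho> n)\<^sup>2) = P + R\<^sub>3"
        unfolding defs by (simp only: distrib_left mult.assoc mult.commute[of z "1 - z"])
      ultimately show "?\<pi> / 2 * (z * (1 - z) + (\<rho> n)\<^sup>2) + ?c * \<rho> n \<le> drift n z"
        by linarith
    qed
  qed
qed

text \<open>
By the Borel-Cantelli lemma crossings from \<open>1 - \<delta>\<close> to \<open>1 - 2 \<delta>\<close> start at finitely many times only, and
\<open>X\<close> is above \<open>1 - \<delta>\<close> at arbitrarily late times. After such a late time a visit below \<open>1 - 2 \<delta>\<close> would complete
a crossing.
\<close>
lemma AE_eventually_above:
  assumes \<rho>: "\<rho> \<longlonglongrightarrow> 0"
    and sum: "filterlim (\<lambda>N. \<Sum>n=1..N. \<rho> n * \<gamma> n) at_top sequentially"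
    and \<delta>: "0 < \<delta>" "\<delta> < 1"
  shows "AE \<omega> in M. eventually (\<lambda>n. 1 - 2 * \<delta> \<le> X n \<omega>) sequentially"
proof -
  let ?\<theta> = "(p\<^sub>A - p\<^sub>B) / 2" and ?l = "1 - 2 * \<delta>" and ?u = "1 - \<delta>"
  have \<theta>: "0 < ?\<theta>" "?\<theta> \<le> 1" using p_bounds by auto
  obtain c where c: "0 < c" and
    ev: "eventually (\<lambda>n. \<forall>z\<in>{0..?u}. ?\<theta> * (z * (1 - z) + (\<rho> n)\<^sup>2) + c * \<rho> n \<le> drift n z) sequentially"
    using drift_lower_bound[OF \<rho> \<delta>] by blast
  have "eventually (\<lambda>n. \<rho> n < 1) sequentially"
    by (rule order_tendstoD(2)[OF \<rho>]) simp
  from eventually_conj[OF ev eventually_conj[OF this eventually_ge_at_top[of 1]]]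
  obtain N where "\<And>n. N \<le> n \<Longrightarrow> (\<forall>z\<in>{0..?u}. ?\<theta> * (z * (1 - z) + (\<rho> n)\<^sup>2) + c * \<rho> n \<le> drift n z) \<and> \<rho> n < 1 \<and> 1 \<le> n"
    unfolding eventually_sequentially by blast
  then have N: "\<And>n z. N \<le> n \<Longrightarrow> z \<in> {0..?u} \<Longrightarrow> ?\<theta> * (z * (1 - z) + (\<rho> n)\<^sup>2) + c * \<rho> n \<le> drift n z"
    "\<And>n. N \<le> n \<Longrightarrow> \<rho> n < 1" "\<And>n. N \<le> n \<Longrightarrow> 1 \<le> n"
    by blast+
  have drift1: "c * \<rho> n \<le> drift n z" and drift2: "?\<theta> * (z * (1 - z) + (\<rho> n)\<^sup>2) \<le> drift n z"
    if "N \<le> n" "z \<in> {0..?u}" for n z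
  proof -
    have "0 \<le> ?\<theta> * (z * (1 - z) + (\<rho> n)\<^sup>2)"
      using that \<theta> \<delta> by (intro mult_nonneg_nonneg add_nonneg_nonneg) auto
    moreover have "0 \<le> c * \<rho> n"
      using c rho_pos[of n] N(3)[OF that(1)] by simp
    ultimately show "c * \<rho> n \<le> drift n z" "?\<theta> * (z * (1 - z) + (\<rho> n)\<^sup>2) \<le> drift n z"
      using N(1)[OF that] by auto
  qed
  \<comment> \<open>The estimates hold from time \<open>N\<close> on; earlier events are made empty, which does not affect the Borel-Cantelli lemma.\<close>
  define E where "E n = (if n < N then {} else (\<Union>m. crossing ?l ?u n (n + m)))" for n
  have E: "E n \<in> events" for n
    using crossing_event by (auto simp: E_def)
  have E_le: "prob (E n) \<le> exp ?\<theta> * exp (- (?\<theta> * \<delta>) / \<gamma> n)" for n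
  proof (cases "n < N")
    case False
    have inc: "incseq (\<lambda>m. crossing ?l ?u n (n + m))"
      by (rule incseq_SucI) (simp add: crossing_Suc)
    have "(\<lambda>m. prob (crossing ?l ?u n (n + m))) \<longlonglongrightarrow> prob (\<Union>m. crossing ?l ?u n (n + m))"
      using crossing_event by (intro finite_Lim_measure_incseq inc) auto
    moreover have "prob (crossing ?l ?u n (n + m)) \<le> exp ?\<theta> * exp (- (?\<theta> * (?u - ?l)) / \<gamma> n)" for m
      by (rule prob_crossing_le) (use False N(3)[of n] \<theta> \<delta> N(2) drift2 in \<open>auto intro: less_imp_le\<close>)
    ultimately have "prob (\<Union>m. crossing ?l ?u n (n + m)) \<le> exp ?\<theta> * exp (- (?\<theta> * (?u - ?l)) / \<gamma> n)"
      by (intro LIMSEQ_le_const2) auto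
    then show ?thesis
      using False by (simp add: E_def)
  qed (simp add: E_def)
  have "summable (\<lambda>n. exp ?\<theta> * exp (- (?\<theta> * \<delta>) / \<gamma> n))"
    using \<theta> \<delta> by (intro summable_mult gamma_exp) simp
  then have "summable (\<lambda>n. prob (E n))"
    by (rule summable_comparison_test'[where N = 0]) (use E_le in simp)
  then have "AE \<omega> in M. eventually (\<lambda>n. \<omega> \<in> space M - E n) sequentially"
    using E by (intro borel_cantelli_AE1) (auto simp: emeasure_eq_measure)
  moreover have "AE \<omega> in M. \<forall>K. \<exists>k\<ge>K. ?u < X k \<omega>"
  proof (subst AE_all_countable, rule allI)
    fix K
    have "AE \<omega> in M. \<exists>k\<ge>max K N. ?u < X k \<omega>"
      using c drift1 by (intro AE_exceeds_once[OF sum c]) auto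
    then show "AE \<omega> in M. \<exists>k\<ge>K. ?u < X k \<omega>"
      by (rule AE_mp) (auto intro!: AE_I2)
  qed
  ultimately show ?thesis
  proof eventually_elim
    case (elim \<omega>)
    then obtain K where K: "\<And>n. K \<le> n \<Longrightarrow> \<omega> \<in> space M - E n"
      unfolding eventually_sequentially by blast
    obtain k where k: "max K N \<le> k" "?u < X k \<omega>"
      using elim(2) by blast
    have "?l \<le> X m \<omega>" if "k \<le> m" for m
      using that
    proof (induction m rule: less_induct)
      case (less m)
      show ?case
      proof (rule ccontr)
        assume low: "\<not> ?l \<le> X m \<omega>"
        \<comment> \<open>The first visit \<open>m\<close> below the lower level and the last time \<open>n\<close> above the upper level before it delimit a crossing.\<close>
        define S where "S = {n \<in> {k..m}. ?u < X n \<omega>}"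
        define n where "n = Max S"
        have S: "finite S" "k \<in> S"
          using k less.prems by (auto simp: S_def)
        then have "n \<in> S" unfolding n_def by (intro Max_in) auto
        then have n: "k \<le> n" "n \<le> m" "?u < X n \<omega>" by (auto simp: S_def)
        moreover have "n \<noteq> m" using n low \<delta> by auto
        ultimately have nm: "n < m" by simp
        have "X j \<omega> \<in> {?l..?u}" if "j \<in> {n<..<m}" for j
        proof -
          have "i \<le> n" if "i \<in> S" for i
            unfolding n_def using S(1) that by (rule Max_ge)
          then have "j \<notin> S"
            using that by force
          then have "X j \<omega> \<le> ?u" using that n by (auto simp: S_def)
          moreover have "?l \<le> X j \<omega>" using less.IH[of j] that n by auto
          ultimately show ?thesis by simp
        qed
        then have "\<omega> \<in> crossing ?l ?u n m"
          using nm n low K[of n] k by (auto simp: crossing_def intro!: bexI[of _ m])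
        moreover have "m = n + (m - n)" using nm by simp
        ultimately have "\<omega> \<in> E n"
          using n k by (auto simp: E_def intro: exI[of _ "m - n"])
        then show False using K[of n] n k by auto
      qed
    qed
    then show ?case
      unfolding eventually_sequentially by blast
  qed
qed

lemma AE_X_tendsto_1:
  assumes \<rho>: "\<rho> \<longlonglongrightarrow> 0"
    and sum: "filterlim (\<lambda>N. \<Sum>n=1..N. \<rho> n * \<gamma> n) at_top sequentially"
  shows "AE \<omega> in M. (\<lambda>n. X n \<omega>) \<longlonglongrightarrow> 1"
proof -
  have "AE \<omega> in M. \<forall>i::nat. eventually (\<lambda>n. 1 - 2 * (1 / real (i + 2)) \<le> X n \<omega>) sequentially"
    by (subst AE_all_countable, intro allI AE_eventually_above[OF \<rho> sum]) (auto simp: field_simps)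
  then show ?thesis
  proof (rule AE_mp, intro AE_I2 impI)
    fix \<omega> assume \<omega>: "\<omega> \<in> space M"
      and above: "\<forall>i::nat. eventually (\<lambda>n. 1 - 2 * (1 / real (i + 2)) \<le> X n \<omega>) sequentially"
    show "(\<lambda>n. X n \<omega>) \<longlonglongrightarrow> 1"
    proof (rule order_tendstoI)
      fix a :: real assume "a < 1"
      then obtain i where i: "inverse (real (Suc i)) < (1 - a) / 2"
        using reals_Archimedean[of "(1 - a) / 2"] by auto
      have "1 / real (i + 2) \<le> inverse (real (Suc i))"
        by (simp add: field_simps)
      then have "1 / real (i + 2) < (1 - a) / 2"
        using i by (rule order_le_less_trans)
      then have "a < 1 - 2 * (1 / real (i + 2))"
        by argo
      then show "eventually (\<lambda>n. a < X n \<omega>) sequentially"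
        using above[rule_format, of i] by (elim eventually_mono) linarith
    next
      fix a :: real assume "1 < a"
      then show "eventually (\<lambda>n. X n \<omega> < a) sequentially"
        using X_range[OF \<omega>] by (intro always_eventually allI) (auto intro: le_less_trans)
    qed
  qed
qed

section \<open>Exponential moments on the scale of the penalty\<close>

text \<open>
The sign \<open>\<sigma>\<close> allows upper and lower deviations of \<open>(1 - X) / \<rho>\<close> from \<open>a\<close> to be treated together. The
hypothesis \<open>contract\<close> says that one step turns the exponent \<open>L\<close> into at most \<open>(1 - \<kappa> \<gamma>) L\<close>, in
mean. Convexity then makes the expectation of \<open>exp L\<close> at the next time at most a convex combination of its
present value and \<open>1\<close>.
\<close>
lemma exponential_moment_bound:
  assumes \<sigma>: "\<sigma>\<^sup>2 = 1" and \<theta>: "0 \<le> \<theta>" "\<theta> \<le> 1" and N: "1 \<le> N" and \<kappa>: "0 \<le> \<kappa>"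
    and small: "\<And>n. N \<le> n \<Longrightarrow> \<rho> (Suc n) \<le> 1" "\<And>n. N \<le> n \<Longrightarrow> \<kappa> * \<gamma> n \<le> 1"
    and S: "S \<in> sets borel"
    and contract: "\<And>n z. N \<le> n \<Longrightarrow> z \<in> S \<Longrightarrow> z \<in> {0..1} \<Longrightarrow>
      \<theta> / \<gamma> (Suc n) * (\<sigma> * (1 - z - a * \<rho> (Suc n))) - \<sigma> * \<theta> * drift (Suc n) z
        + \<theta>\<^sup>2 * (z * (1 - z) + (\<rho> (Suc n))\<^sup>2)
      \<le> (1 - \<kappa> * \<gamma> n) * (\<theta> / \<gamma> n * (\<sigma> * (1 - z - a * \<rho> n)))"
  shows "\<exists>K. \<forall>n\<ge>N. expectation (\<lambda>\<omega>. indicator (staying N n S) \<omega> *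
      exp (\<theta> / \<gamma> n * (\<sigma> * (1 - X n \<omega> - a * \<rho> n)))) \<le> K"
proof -
  define L where "L n \<omega> = \<theta> / \<gamma> n * (\<sigma> * (1 - X n \<omega> - a * \<rho> n))" for n \<omega>
  define G where "G n = staying N n S" for n
  \<comment> \<open>\<open>L n\<close> is an affine function of \<open>X n\<close> with slope \<open>t n\<close> and constant term \<open>c n\<close>.\<close>
  define t where "t n = - \<sigma> * (\<theta> / \<gamma> n)" for n
  define c where "c n = \<theta> / \<gamma> n * (\<sigma> * (1 - a * \<rho> n))" for n
  have G: "G n \<in> events" and Gpast: "G n \<in> sets (past n)" for n
    by (simp_all add: G_def staying_event staying_past S)
  have L_eq: "L n \<omega> = c n + t n * X n \<omega>" for n \<omega>
    by (simp add: L_def c_def t_def algebra_simps diff_divide_distrib add_divide_distrib)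
  have int: "integrable M (\<lambda>\<omega>. indicator (G m) \<omega> * exp (p + q * L n \<omega>))" for m n p q
  proof -
    have "(\<lambda>\<omega>. indicator (G m) \<omega> * exp (p + q * L n \<omega>)) =
        (\<lambda>\<omega>. exp (p + q * c n) * (indicator (G m) \<omega> * exp (q * t n * X n \<omega>)))"
      by (simp add: L_eq algebra_simps exp_add)
    then show ?thesis
      using integrable_exp_X[OF G] by simp
  qed
  have int1: "integrable M (\<lambda>\<omega>. indicator (G m) \<omega> * exp (L n \<omega>))" for m n
    using int[of m 0 1 n] by simp
  define K where "K = max 1 (expectation (\<lambda>\<omega>. indicator (G N) \<omega> * exp (L N \<omega>)))"
  have "expectation (\<lambda>\<omega>. indicator (G n) \<omega> * exp (L n \<omega>)) \<le> K" if "N \<le> n" for n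
    using that
  proof (induction n rule: dec_induct)
    case base
    show ?case by (simp add: K_def)
  next
    case (step n)
    define s where "s = 1 - \<kappa> * \<gamma> n"
    have \<gamma>: "0 < \<gamma> n" "0 < \<gamma> (Suc n)" using gamma_pos step.hyps N by auto
    have s: "0 \<le> s" "s \<le> 1"
      using small(2)[OF step.hyps(1)] \<kappa> \<gamma> by (auto simp: s_def)
    have t\<gamma>: "t (Suc n) * \<gamma> (Suc n) = - \<sigma> * \<theta>"
      using \<gamma> by (simp add: t_def)
    have \<sigma>1: "\<bar>\<sigma>\<bar> = 1"
      using \<sigma> by (auto simp: power2_eq_1_iff)
    have "expectation (\<lambda>\<omega>. indicator (G (Suc n)) \<omega> * exp (L (Suc n) \<omega>)) \<le> expectation (\<lambda>\<omega>. indicator (G n) \<omega> * exp (L (Suc n) \<omega>))"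
      by (rule integral_mono[OF int1 int1], rule mult_right_mono)
        (use staying_Suc_subset[of N n S] in \<open>auto simp: indicator_def G_def\<close>)
    also have "\<dots> = exp (c (Suc n)) * expectation (\<lambda>\<omega>. indicator (G n) \<omega> * exp (t (Suc n) * X (Suc n) \<omega>))"
      unfolding L_eq exp_add
      by (simp only: mult.left_commute[of _ "exp (c (Suc n))"] integral_mult_right_zero)
    also have "\<dots> \<le> exp (c (Suc n)) * expectation (\<lambda>\<omega>. indicator (G n) \<omega> * exp (- c (Suc n) + s * L n \<omega>))"
    proof (intro mult_left_mono expectation_exp_step)
      show "1 \<le> n" "\<rho> (Suc n) \<le> 1" "G n \<in> sets (past n)"
        using N step.hyps small Gpast by auto
      show "\<bar>t (Suc n) * \<gamma> (Suc n)\<bar> \<le> 1"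
        unfolding t\<gamma> using \<theta> \<sigma>1 by (simp add: abs_mult)
      show "integrable M (\<lambda>\<omega>. indicator (G n) \<omega> * exp (- c (Suc n) + s * L n \<omega>))"
        by (rule int)
      fix \<omega> assume \<omega>: "\<omega> \<in> G n"
      then have z: "X n \<omega> \<in> S" "X n \<omega> \<in> {0..1}"
        using step.hyps X_range[of \<omega> n] by (auto simp: G_def staying_def)
      have "c (Suc n) + t (Suc n) * X n \<omega> - \<sigma> * \<theta> * drift (Suc n) (X n \<omega>)
          + \<theta>\<^sup>2 * (X n \<omega> * (1 - X n \<omega>) + (\<rho> (Suc n))\<^sup>2) \<le> s * L n \<omega>"
        using contract[OF step.hyps(1) z]
        by (simp add: c_def t_def s_def L_def algebra_simps diff_divide_distrib add_divide_distrib)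
      then show "t (Suc n) * X n \<omega> + t (Suc n) * \<gamma> (Suc n) * drift (Suc n) (X n \<omega>)
          + (t (Suc n) * \<gamma> (Suc n))\<^sup>2 * (X n \<omega> * (1 - X n \<omega>) + (\<rho> (Suc n))\<^sup>2) \<le> - c (Suc n) + s * L n \<omega>"
        unfolding t\<gamma> by (simp add: power_mult_distrib \<sigma>)
    qed simp
    also have "\<dots> = expectation (\<lambda>\<omega>. indicator (G n) \<omega> * exp (s * L n \<omega>))"
      unfolding exp_add mult.left_commute[of _ "exp (- c (Suc n))"] integral_mult_right_zero
      by (simp add: exp_minus)
    also have "\<dots> \<le> expectation (\<lambda>\<omega>. s * (indicator (G n) \<omega> * exp (L n \<omega>)) + (1 - s))"
    proof (rule integral_mono)
      show "integrable M (\<lambda>\<omega>. indicator (G n) \<omega> * exp (s * L n \<omega>))"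
        using int[of n 0 s n] by simp
      show "integrable M (\<lambda>\<omega>. s * (indicator (G n) \<omega> * exp (L n \<omega>)) + (1 - s))"
        by (intro Bochner_Integration.integrable_add integrable_mult_right int1) simp
      show "indicator (G n) \<omega> * exp (s * L n \<omega>) \<le> s * (indicator (G n) \<omega> * exp (L n \<omega>)) + (1 - s)" for \<omega>
        using exp_mult_le[OF s, of "L n \<omega>"] s by (simp add: indicator_def)
    qed
    also have "\<dots> = s * expectation (\<lambda>\<omega>. indicator (G n) \<omega> * exp (L n \<omega>)) + (1 - s)"
      by (subst Bochner_Integration.integral_add) (auto intro!: integrable_mult_right int1 simp: prob_space)
    also have "\<dots> \<le> s * K + (1 - s) * K"
      using step.IH s by (intro add_mono mult_left_mono) (auto simp: K_def mult_le_cancel_left1)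
    also have "\<dots> = K" by (simp add: algebra_simps)
    finally show ?case .
  qed
  then show ?thesis
    unfolding L_def G_def by blast
qed

text \<open>
Markov's inequality for the exponential moment, followed by the Borel-Cantelli lemma.
\<close>
lemma AE_eventually_le:
  assumes \<theta>: "0 < \<theta>" and N: "1 \<le> N" and S: "S \<in> sets borel" and \<epsilon>: "0 < \<epsilon>"
    and moment: "\<And>n. N \<le> n \<Longrightarrow> expectation (\<lambda>\<omega>. indicator (staying N n S) \<omega> *
      exp (\<theta> / \<gamma> n * (\<sigma> * (1 - X n \<omega> - a * \<rho> n)))) \<le> K"
    and summable: "summable (\<lambda>n. exp (- (\<theta> * \<epsilon>) * (\<rho> n / \<gamma> n)))"
  shows "AE \<omega> in M. (\<forall>n\<ge>N. X n \<omega> \<in> S) \<longrightarrow>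
    eventually (\<lambda>n. \<sigma> * (1 - X n \<omega> - a * \<rho> n) \<le> \<epsilon> * \<rho> n) sequentially"
proof -
  define D where "D n \<omega> = \<sigma> * (1 - X n \<omega> - a * \<rho> n)" for n \<omega>
  have [measurable]: "D n \<in> borel_measurable M" for n
    unfolding D_def by measurable
  have [measurable]: "staying N n S \<in> events" for n
    by (rule staying_event[OF S])
  define E where "E n = (if n < N then {} else staying N n S \<inter> {\<omega> \<in> space M. \<epsilon> * \<rho> n < D n \<omega>})" for n
  have E [measurable]: "E n \<in> events" for n
    by (cases "n < N") (simp_all add: E_def)
  have E_le: "prob (E n) \<le> K * exp (- (\<theta> * \<epsilon>) * (\<rho> n / \<gamma> n))" if n: "N \<le> n" for n
  proof -
    have \<gamma>: "0 < \<gamma> n" using gamma_pos n N by simp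
    let ?v = "\<theta> * \<epsilon> * (\<rho> n / \<gamma> n)"
    have "exp ?v * prob (E n) = expectation (\<lambda>\<omega>. exp ?v * indicator (E n) \<omega>)"
      using E[of n] sets.sets_into_space[OF E[of n]] by (simp add: Int_absorb2)
    also have "\<dots> \<le> expectation (\<lambda>\<omega>. indicator (staying N n S) \<omega> * exp (\<theta> / \<gamma> n * D n \<omega>))"
    proof (rule integral_mono)
      show "integrable M (\<lambda>\<omega>. exp ?v * indicator (E n) \<omega>)"
        by (intro integrable_mult_right integrable_bounded[of _ 1]) (auto simp: indicator_def)
      have "\<theta> / \<gamma> n * D n \<omega> = \<theta> / \<gamma> n * (\<sigma> * (1 - a * \<rho> n)) + (- \<sigma> * (\<theta> / \<gamma> n)) * X n \<omega>" for \<omega>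
        by (simp add: D_def algebra_simps diff_divide_distrib add_divide_distrib)
      then have eq: "(\<lambda>\<omega>. indicator (staying N n S) \<omega> * exp (\<theta> / \<gamma> n * D n \<omega>)) =
          (\<lambda>\<omega>. exp (\<theta> / \<gamma> n * (\<sigma> * (1 - a * \<rho> n))) * (indicator (staying N n S) \<omega> * exp ((- \<sigma> * (\<theta> / \<gamma> n)) * X n \<omega>)))"
        by (simp only: exp_add mult_ac)
      show "integrable M (\<lambda>\<omega>. indicator (staying N n S) \<omega> * exp (\<theta> / \<gamma> n * D n \<omega>))"
        unfolding eq by (intro integrable_mult_right integrable_exp_X staying_event S)
      fix \<omega> assume "\<omega> \<in> space M"
      show "exp ?v * indicator (E n) \<omega> \<le> indicator (staying N n S) \<omega> * exp (\<theta> / \<gamma> n * D n \<omega>)"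
      proof (cases "\<omega> \<in> E n")
        case True
        then have st: "\<omega> \<in> staying N n S" and "\<epsilon> * \<rho> n \<le> D n \<omega>"
          using n by (auto simp: E_def)
        then have "\<theta> / \<gamma> n * (\<epsilon> * \<rho> n) \<le> \<theta> / \<gamma> n * D n \<omega>"
          using \<theta> \<gamma> by (intro mult_left_mono) auto
        then show ?thesis
          using st True by simp
      qed simp
    qed
    also have "\<dots> \<le> K"
      unfolding D_def by (rule moment[OF n])
    finally show ?thesis
      by (simp add: exp_minus field_simps)
  qed
  have "summable (\<lambda>n. prob (E n))"
    by (rule summable_comparison_test'[where N = N, OF summable_mult[OF summable, of K]])
      (use E_le in auto)
  then have "AE \<omega> in M. eventually (\<lambda>n. \<omega> \<in> space M - E n) sequentially"
    using E by (intro borel_cantelli_AE1) (auto simp: emeasure_eq_measure)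
  then show ?thesis
  proof (rule AE_mp, intro AE_I2 impI)
    fix \<omega>
    assume \<omega>: "\<omega> \<in> space M" "\<forall>n\<ge>N. X n \<omega> \<in> S" and "eventually (\<lambda>n. \<omega> \<in> space M - E n) sequentially"
    then have "eventually (\<lambda>n. \<omega> \<in> space M - E n \<and> N \<le> n) sequentially"
      by (intro eventually_conj eventually_ge_at_top)
    then show "eventually (\<lambda>n. \<sigma> * (1 - X n \<omega> - a * \<rho> n) \<le> \<epsilon> * \<rho> n) sequentially"
      using \<omega> by (elim eventually_mono) (auto simp: E_def D_def staying_def not_less)
  qed
qed

end

section \<open>The rate of convergence\<close>

text \<open>
The asymptotic assumptions in the form in which they are used: quotients that tend to zero, and summability
for the exponent \<open>\<rho> / \<gamma>\<close>. The last one follows from summability for \<open>\<rho> powr (1 + \<eta>) / \<gamma>\<close>, which is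
smaller once \<open>\<rho> < 1\<close>.
\<close>
locale slowly_varying_bandit = penalized_bandit +
  assumes rho_lim: "\<rho> \<longlonglongrightarrow> 0"
    and gamma_rho_lim: "(\<lambda>n. \<gamma> n / \<rho> n) \<longlonglongrightarrow> 0"
    and rho_gamma_sum: "filterlim (\<lambda>N. \<Sum>n=1..N. \<rho> n * \<gamma> n) at_top sequentially"
    and rho_increment: "(\<lambda>n. (\<rho> (Suc n) - \<rho> n) / (\<rho> (Suc n) * \<gamma> (Suc n))) \<longlonglongrightarrow> 0"
    and gamma_increment: "(\<lambda>n. (\<gamma> (Suc n) - \<gamma> n) / (\<gamma> (Suc n))\<^sup>2) \<longlonglongrightarrow> 0"
    and exp_rho_gamma: "\<And>C. 0 < C \<Longrightarrow> summable (\<lambda>n. exp (- C * (\<rho> n / \<gamma> n)))"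
begin

lemma eventually_ge_1: "eventually (\<lambda>n::nat. 1 \<le> n) sequentially"
  by (rule eventually_ge_at_top)

lemma gamma_lim: "\<gamma> \<longlonglongrightarrow> 0"
proof -
  have "(\<lambda>n. \<gamma> n / \<rho> n * \<rho> n) \<longlonglongrightarrow> 0"
    using tendsto_mult[OF gamma_rho_lim rho_lim] by simp
  moreover have "eventually (\<lambda>n. \<gamma> n / \<rho> n * \<rho> n = \<gamma> n) sequentially"
    using eventually_ge_1 by eventually_elim (use rho_pos in fastforce)
  ultimately show ?thesis
    by (rule Lim_transform_eventually)
qed

text \<open>
The exponent \<open>\<theta> / \<gamma> n\<close> of the exponential moments changes from step to step. The change is negligible against
the contraction, which reduces the exponent by \<open>\<theta> \<kappa>\<close>.
\<close>
lemma inverse_gamma_increment: "(\<lambda>n. 1 / \<gamma> (Suc n) - 1 / \<gamma> n) \<longlonglongrightarrow> 0"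
proof (rule Lim_null_comparison)
  show "(\<lambda>n. \<bar>(\<gamma> (Suc n) - \<gamma> n) / (\<gamma> (Suc n))\<^sup>2\<bar>) \<longlonglongrightarrow> 0"
    using gamma_increment by (rule tendsto_rabs_zero)
  show "eventually (\<lambda>n. norm (1 / \<gamma> (Suc n) - 1 / \<gamma> n) \<le> \<bar>(\<gamma> (Suc n) - \<gamma> n) / (\<gamma> (Suc n))\<^sup>2\<bar>) sequentially"
    using eventually_ge_1
  proof eventually_elim
    case (elim n)
    then have \<gamma>: "0 < \<gamma> n" "0 < \<gamma> (Suc n)" "\<gamma> (Suc n) \<le> \<gamma> n"
      using gamma_pos gamma_decreasing by auto
    have "norm (1 / \<gamma> (Suc n) - 1 / \<gamma> n) = (\<gamma> n - \<gamma> (Suc n)) / (\<gamma> n * \<gamma> (Suc n))"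
      using \<gamma> by (simp add: field_simps abs_div_pos)
    also have "\<dots> \<le> (\<gamma> n - \<gamma> (Suc n)) / (\<gamma> (Suc n))\<^sup>2"
      using \<gamma> by (intro divide_left_mono) (auto simp: power2_eq_square)
    also have "\<dots> = \<bar>(\<gamma> (Suc n) - \<gamma> n) / (\<gamma> (Suc n))\<^sup>2\<bar>"
      using \<gamma> by (simp add: abs_divide)
    finally show ?case .
  qed
qed

lemma rho_ratio: "(\<lambda>n. \<rho> (Suc n) / \<rho> n) \<longlonglongrightarrow> 1"
proof -
  have "(\<lambda>n. (\<rho> (Suc n) - \<rho> n) / (\<rho> (Suc n) * \<gamma> (Suc n)) * \<gamma> (Suc n)) \<longlonglongrightarrow> 0 * 0"
    by (intro tendsto_mult rho_increment LIMSEQ_Suc gamma_lim)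
  then have "(\<lambda>n. inverse (1 - (\<rho> (Suc n) - \<rho> n) / (\<rho> (Suc n) * \<gamma> (Suc n)) * \<gamma> (Suc n))) \<longlonglongrightarrow> inverse (1 - 0 * 0)"
    by (intro tendsto_inverse tendsto_diff tendsto_const) auto
  moreover have "eventually (\<lambda>n. inverse (1 - (\<rho> (Suc n) - \<rho> n) / (\<rho> (Suc n) * \<gamma> (Suc n)) * \<gamma> (Suc n)) = \<rho> (Suc n) / \<rho> n) sequentially"
    using eventually_ge_1
  proof eventually_elim
    case (elim n)
    then have "0 < \<rho> n" "0 < \<rho> (Suc n)" "0 < \<gamma> (Suc n)"
      using rho_pos gamma_pos by auto
    then show ?case by (simp add: field_simps)
  qed
  ultimately show ?thesis
    using Lim_transform_eventually by fastforce
qed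

text \<open>
The same for the centring \<open>\<theta> a \<rho> n / \<gamma> n\<close>: its change is negligible against the contributions of the
drift, which are of order \<open>\<rho> n\<close>.
\<close>
lemma rho_over_gamma_increment: "(\<lambda>n. (\<rho> n / \<gamma> n - \<rho> (Suc n) / \<gamma> (Suc n)) / \<rho> n) \<longlonglongrightarrow> 0"
proof -
  have "(\<lambda>n. - (1 / \<gamma> (Suc n) - 1 / \<gamma> n) - (\<rho> (Suc n) - \<rho> n) / (\<rho> (Suc n) * \<gamma> (Suc n)) * (\<rho> (Suc n) / \<rho> n)) \<longlonglongrightarrow> - 0 - 0 * 1"
    by (intro tendsto_diff tendsto_minus tendsto_mult rho_increment rho_ratio inverse_gamma_increment)
  moreover have "eventually (\<lambda>n. - (1 / \<gamma> (Suc n) - 1 / \<gamma> n) - (\<rho> (Suc n) - \<rho> n) / (\<rho> (Suc n) * \<gamma> (Suc n)) * (\<rho> (Suc n) / \<rho> n)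
      = (\<rho> n / \<gamma> n - \<rho> (Suc n) / \<gamma> (Suc n)) / \<rho> n) sequentially"
    using eventually_ge_1
  proof eventually_elim
    case (elim n)
    then have "0 < \<rho> n" "0 < \<rho> (Suc n)" "0 < \<gamma> (Suc n)" "0 < \<gamma> n"
      using rho_pos gamma_pos by auto
    then show ?case by (simp add: field_simps)
  qed
  ultimately show ?thesis
    using Lim_transform_eventually by fastforce
qed

text \<open>
Choose \<open>a\<close> between the limit \<open>q / \<pi>\<close> and \<open>c\<close>, where \<open>q = 1 - p\<^sub>A\<close> and \<open>\<pi> = p\<^sub>A - p\<^sub>B\<close>, and then a
contraction rate \<open>\<kappa> < \<pi>\<close> with \<open>q < \<kappa> a\<close>. While \<open>Y = 1 - X\<close> is below \<open>\<theta>\<close>, drift and noise together pull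
\<open>Y\<close> down at rate at least \<open>(\<pi> - \<theta>) (1 - \<theta>) \<ge> \<kappa> + 2 \<theta>\<close>, and the penalty pushes it up by at most
\<open>q \<rho>\<close>. The surplus \<open>2 \<theta>\<close> absorbs the change of \<open>1 / \<gamma>\<close>, and \<open>\<kappa> a - q\<close> absorbs the remaining errors of
order \<open>o(\<rho>)\<close>. Convergence to \<open>1\<close> provides the localization.
\<close>
lemma AE_upper_bound:
  assumes c: "(1 - p\<^sub>A) / (p\<^sub>A - p\<^sub>B) < c"
  shows "AE \<omega> in M. eventually (\<lambda>n. (1 - X n \<omega>) / \<rho> n \<le> c) sequentially"
proof -
  let ?\<pi> = "p\<^sub>A - p\<^sub>B" and ?q = "1 - p\<^sub>A"
  have \<pi>: "0 < ?\<pi>" "?\<pi> \<le> 1" and q: "0 < ?q"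
    using p_bounds by auto
  obtain a where a: "?q / ?\<pi> < a" "a < c"
    using dense[OF c] by blast
  have a0: "0 < a" using a q \<pi> by (meson divide_pos_pos less_trans)
  have qa: "?q / a < ?\<pi>"
    using a a0 \<pi> by (simp add: field_simps)
  obtain \<kappa> where \<kappa>: "?q / a < \<kappa>" "\<kappa> < ?\<pi>"
    using dense[OF qa] by blast
  have \<kappa>0: "0 < \<kappa>" using \<kappa> q a0 by (meson divide_pos_pos less_trans)
  have \<kappa>a: "?q < \<kappa> * a"
    using \<kappa> a0 by (simp add: field_simps)
  define \<theta> where "\<theta> = (?\<pi> - \<kappa>) / 4"
  have \<theta>: "0 < \<theta>" "\<theta> \<le> 1" "\<theta> < ?\<pi>" "4 * \<theta> = ?\<pi> - \<kappa>"
    using \<kappa> \<kappa>0 \<pi> by (auto simp: \<theta>_def)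
  have "(?\<pi> - \<theta>) * (1 - \<theta>) = \<kappa> + 2 * \<theta> + \<theta> * (1 - ?\<pi>) + \<theta>\<^sup>2"
    using \<theta>(4) by (simp add: power2_eq_square algebra_simps)
  then have rate: "\<kappa> + 2 * \<theta> \<le> (?\<pi> - \<theta>) * (1 - \<theta>)"
    using \<theta> \<pi> by simp
  define S where "S = {1 - \<theta>..}"
  have "(\<lambda>n. a * ((\<rho> n / \<gamma> n - \<rho> (Suc n) / \<gamma> (Suc n)) / \<rho> n) + \<rho> (Suc n) / \<rho> n * (?q + \<theta> * \<rho> (Suc n)))
      \<longlonglongrightarrow> a * 0 + 1 * (?q + \<theta> * 0)"
    by (intro tendsto_intros rho_over_gamma_increment rho_ratio LIMSEQ_Suc rho_lim)
  then have "eventually (\<lambda>n. a * ((\<rho> n / \<gamma> n - \<rho> (Suc n) / \<gamma> (Suc n)) / \<rho> n) + \<rho> (Suc n) / \<rho> n * (?q + \<theta> * \<rho> (Suc n))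
      < \<kappa> * a) sequentially"
    using \<kappa>a by (intro order_tendstoD(2)) auto
  moreover have "eventually (\<lambda>n. 1 / \<gamma> (Suc n) - 1 / \<gamma> n < 2 * \<theta>) sequentially"
    using \<theta> by (intro order_tendstoD(2)[OF inverse_gamma_increment]) auto
  moreover have "eventually (\<lambda>n. \<rho> (Suc n) < 1) sequentially"
    by (rule order_tendstoD(2)[OF LIMSEQ_Suc[OF rho_lim]]) simp
  ultimately have "eventually (\<lambda>n. 1 \<le> n \<and> a * ((\<rho> n / \<gamma> n - \<rho> (Suc n) / \<gamma> (Suc n)) / \<rho> n)
      + \<rho> (Suc n) / \<rho> n * (?q + \<theta> * \<rho> (Suc n)) < \<kappa> * a
      \<and> 1 / \<gamma> (Suc n) - 1 / \<gamma> n < 2 * \<theta> \<and> \<rho> (Suc n) < 1) sequentially"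
    using eventually_ge_1 by eventually_elim simp
  then obtain N\<^sub>0 where N\<^sub>0: "\<And>n. N\<^sub>0 \<le> n \<Longrightarrow> 1 \<le> n \<and> a * ((\<rho> n / \<gamma> n - \<rho> (Suc n) / \<gamma> (Suc n)) / \<rho> n)
      + \<rho> (Suc n) / \<rho> n * (?q + \<theta> * \<rho> (Suc n)) < \<kappa> * a
      \<and> 1 / \<gamma> (Suc n) - 1 / \<gamma> n < 2 * \<theta> \<and> \<rho> (Suc n) < 1"
    unfolding eventually_sequentially by blast
  have good: "AE \<omega> in M. (\<forall>n\<ge>N. X n \<omega> \<in> S) \<longrightarrow>
      eventually (\<lambda>n. 1 * (1 - X n \<omega> - a * \<rho> n) \<le> (c - a) * \<rho> n) sequentially" if N: "N\<^sub>0 \<le> N" for N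
  proof -
    have N1: "1 \<le> N" using N N\<^sub>0 by simp
    have "\<exists>K. \<forall>n\<ge>N. expectation (\<lambda>\<omega>. indicator (staying N n S) \<omega> *
      exp (\<theta> / \<gamma> n * (1 * (1 - X n \<omega> - a * \<rho> n)))) \<le> K"
    proof (rule exponential_moment_bound[where \<kappa> = \<kappa>])
      fix n assume n: "N \<le> n"
      then have n0: "N\<^sub>0 \<le> n" using N by simp
      note facts = N\<^sub>0[OF n0]
      have \<gamma>: "0 < \<gamma> n" "0 < \<gamma> (Suc n)" "\<gamma> n < 1" and \<rho>: "0 < \<rho> n" "0 < \<rho> (Suc n)"
        using facts gamma_pos rho_pos gamma_less_1 by auto
      show "\<rho> (Suc n) \<le> 1" using facts by simp
      show "\<kappa> * \<gamma> n \<le> 1" using \<kappa> \<pi> \<gamma> \<kappa>0 by (intro mult_le_one) auto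
      fix z assume z: "z \<in> S" "z \<in> {0..1}"
      define y where "y = 1 - z"
      have y: "0 \<le> y" "y \<le> \<theta>" "y \<le> 1" using z by (auto simp: y_def S_def)
      let ?g = "\<gamma> (Suc n)" and ?r = "\<rho> (Suc n)"
      let ?e = "\<rho> n / \<gamma> n - ?r / ?g"
      have balance: "a * ?e + ?r * (?q + \<theta> * ?r) \<le> \<kappa> * a * \<rho> n"
      proof -
        have "\<rho> n * (a * (?e / \<rho> n) + ?r / \<rho> n * (?q + \<theta> * ?r)) \<le> \<rho> n * (\<kappa> * a)"
          using facts \<rho> by (intro mult_left_mono) auto
        then show ?thesis
          using \<rho> by (simp only: distrib_left) (simp add: mult_ac)
      qed
      have slope: "y * (1 / ?g - 1 / \<gamma> n) \<le> y * (2 * \<theta>)"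
        using facts y by (intro mult_left_mono) auto
      have "(\<kappa> + 2 * \<theta>) * y \<le> (?\<pi> - \<theta>) * (1 - \<theta>) * y"
        using rate y by (intro mult_right_mono) auto
      also have "\<dots> \<le> (?\<pi> - \<theta>) * z * y"
        using y \<theta> by (intro mult_right_mono mult_left_mono) (auto simp: y_def)
      finally have pull: "(\<kappa> + 2 * \<theta>) * y \<le> (?\<pi> - \<theta>) * z * y" .
      have push: "?r * (?q * z\<^sup>2) \<le> ?r * (?q * 1)"
        using z \<rho> q by (intro mult_left_mono power_le_one) auto
      have nonneg: "0 \<le> ?r * ((1 - p\<^sub>B) * y\<^sup>2)"
        using \<rho> p_bounds by simp
      have drift: "drift (Suc n) z = ?\<pi> * z * y - ?r * (?q * z\<^sup>2) + ?r * ((1 - p\<^sub>B) * y\<^sup>2)"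
        unfolding drift_def y_def by (simp add: right_diff_distrib)
      \<comment> \<open>The contraction hypothesis divided by \<open>\<theta>\<close>. The right-hand side below lists the change of \<open>1 / \<gamma>\<close>, the terms of order \<open>\<rho>\<close>, the pull of the drift, and two nonpositive remainders.\<close>
      have "(y - a * ?r) / ?g - drift (Suc n) z + \<theta> * (z * y + ?r\<^sup>2) - (1 / \<gamma> n - \<kappa>) * (y - a * \<rho> n)
          = y * (1 / ?g - 1 / \<gamma> n) + (a * ?e + ?r * (?q + \<theta> * ?r)) - \<kappa> * a * \<rho> n + \<kappa> * y - (?\<pi> - \<theta>) * z * y
            + (?r * (?q * z\<^sup>2) - ?r * (?q * 1)) - ?r * ((1 - p\<^sub>B) * y\<^sup>2)"
        unfolding drift by (simp add: algebra_simps diff_divide_distrib power2_eq_square)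
      also have "\<dots> \<le> 0"
        using balance slope pull push nonneg by (simp add: algebra_simps)
      finally have *: "(y - a * ?r) / ?g - drift (Suc n) z + \<theta> * (z * y + ?r\<^sup>2) \<le> (1 / \<gamma> n - \<kappa>) * (y - a * \<rho> n)"
        by simp
      have "\<theta> / ?g * (1 * (1 - z - a * ?r)) - 1 * \<theta> * drift (Suc n) z + \<theta>\<^sup>2 * (z * (1 - z) + ?r\<^sup>2)
          = \<theta> * ((y - a * ?r) / ?g - drift (Suc n) z + \<theta> * (z * y + ?r\<^sup>2))"
        by (simp add: y_def algebra_simps diff_divide_distrib add_divide_distrib power2_eq_square)
      also have "\<dots> \<le> \<theta> * ((1 / \<gamma> n - \<kappa>) * (y - a * \<rho> n))"
        using * \<theta> by (intro mult_left_mono) auto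
      also have "\<dots> = (1 - \<kappa> * \<gamma> n) * (\<theta> / \<gamma> n * (1 * (1 - z - a * \<rho> n)))"
        using \<gamma> by (simp add: y_def field_simps)
      finally show "\<theta> / ?g * (1 * (1 - z - a * ?r)) - 1 * \<theta> * drift (Suc n) z + \<theta>\<^sup>2 * (z * (1 - z) + ?r\<^sup>2)
          \<le> (1 - \<kappa> * \<gamma> n) * (\<theta> / \<gamma> n * (1 * (1 - z - a * \<rho> n)))" .
    qed (use \<theta> \<kappa>0 N1 in \<open>auto simp: S_def\<close>)
    then obtain K where K: "\<And>n. N \<le> n \<Longrightarrow> expectation (\<lambda>\<omega>. indicator (staying N n S) \<omega> *
      exp (\<theta> / \<gamma> n * (1 * (1 - X n \<omega> - a * \<rho> n)))) \<le> K"
      by blast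
    show ?thesis
      by (rule AE_eventually_le[OF \<theta>(1) N1 _ _ K])
        (use a \<theta> exp_rho_gamma[of "\<theta> * (c - a)"] in \<open>auto simp: S_def\<close>)
  qed
  have "AE \<omega> in M. \<forall>N. N\<^sub>0 \<le> N \<longrightarrow> (\<forall>n\<ge>N. X n \<omega> \<in> S) \<longrightarrow>
      eventually (\<lambda>n. 1 * (1 - X n \<omega> - a * \<rho> n) \<le> (c - a) * \<rho> n) sequentially"
    unfolding AE_all_countable using good by auto
  then show ?thesis
    using AE_X_tendsto_1[OF rho_lim rho_gamma_sum]
  proof eventually_elim
    case (elim \<omega>)
    have "eventually (\<lambda>n. 1 - \<theta> < X n \<omega>) sequentially"
      using \<theta> by (intro order_tendstoD(1)[OF elim(2)]) simp
    then obtain N where "\<And>n. N \<le> n \<Longrightarrow> 1 - \<theta> < X n \<omega>"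
      unfolding eventually_sequentially by blast
    then have "\<forall>n\<ge>max N N\<^sub>0. X n \<omega> \<in> S"
      by (auto simp: S_def intro: less_imp_le)
    then have "eventually (\<lambda>n. 1 * (1 - X n \<omega> - a * \<rho> n) \<le> (c - a) * \<rho> n) sequentially"
      using elim(1) by (meson max.cobounded2)
    then show ?case
      using eventually_ge_1
    proof eventually_elim
      case (elim n)
      then show ?case
        using rho_pos[of n] by (simp add: field_simps)
    qed
  qed
qed

text \<open>
The mirror image, with \<open>b\<close> between \<open>c\<close> and \<open>q / \<pi>\<close>, taken positive, and a rate \<open>\<kappa> > \<pi>\<close> with \<open>\<kappa> b < q\<close>.
The pull \<open>\<pi> X Y \<le> \<pi> Y\<close> is now bounded in the right direction for every \<open>Y\<close>, so the estimate holds on the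
whole interval, with \<open>S = UNIV\<close>. The monotonicity of \<open>\<gamma>\<close> takes care of the change of \<open>1 / \<gamma>\<close>.
\<close>
lemma AE_lower_bound:
  assumes c: "c < (1 - p\<^sub>A) / (p\<^sub>A - p\<^sub>B)"
  shows "AE \<omega> in M. eventually (\<lambda>n. c \<le> (1 - X n \<omega>) / \<rho> n) sequentially"
proof -
  let ?\<pi> = "p\<^sub>A - p\<^sub>B" and ?q = "1 - p\<^sub>A"
  have \<pi>: "0 < ?\<pi>" "?\<pi> \<le> 1" and q: "0 < ?q" "?q \<le> 1"
    using p_bounds by auto
  have "max c 0 < ?q / ?\<pi>" using c \<pi> q by simp
  then obtain b where b: "max c 0 < b" "b < ?q / ?\<pi>"
    using dense by blast
  have b0: "0 < b" "c < b" using b by auto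
  have gap: "0 < ?q - b * ?\<pi>"
    using b \<pi> by (simp add: field_simps)
  define \<theta> where "\<theta> = (?q - b * ?\<pi>) / (4 * (b + 1))"
  define \<kappa> where "\<kappa> = ?\<pi> + 2 * \<theta>"
  have \<theta>0: "0 < \<theta>" using gap b0 by (simp add: \<theta>_def)
  have four: "4 * \<theta> * b + 4 * \<theta> = ?q - b * ?\<pi>"
  proof -
    have "\<theta> * (4 * (b + 1)) = ?q - b * ?\<pi>"
      unfolding \<theta>_def using b0 by (intro nonzero_eq_divide_eq[THEN iffD1, OF _ refl]) simp
    then show ?thesis by (simp add: algebra_simps)
  qed
  have \<theta>b: "0 < \<theta> * b" using \<theta>0 b0 by simp
  have \<theta>1: "\<theta> \<le> 1"
  proof -
    have "0 < b * ?\<pi>" using b0 \<pi> by simp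
    then show ?thesis using four \<theta>b q by linarith
  qed
  have \<kappa>0: "0 < \<kappa>" using \<pi> \<theta>0 by (simp add: \<kappa>_def)
  have \<kappa>b: "\<kappa> * b < ?q"
  proof -
    have "\<kappa> * b = b * ?\<pi> + 2 * (\<theta> * b)" by (simp add: \<kappa>_def algebra_simps)
    then show ?thesis using four \<theta>b \<theta>0 by linarith
  qed
  have "(\<lambda>n. \<rho> (Suc n) / \<rho> n * (?q - \<theta> * \<rho> (Suc n)) + b * ((\<rho> n / \<gamma> n - \<rho> (Suc n) / \<gamma> (Suc n)) / \<rho> n))
      \<longlonglongrightarrow> 1 * (?q - \<theta> * 0) + b * 0"
    by (intro tendsto_intros rho_over_gamma_increment rho_ratio LIMSEQ_Suc rho_lim)
  then have "eventually (\<lambda>n. \<kappa> * b < \<rho> (Suc n) / \<rho> n * (?q - \<theta> * \<rho> (Suc n))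
      + b * ((\<rho> n / \<gamma> n - \<rho> (Suc n) / \<gamma> (Suc n)) / \<rho> n)) sequentially"
    using \<kappa>b by (intro order_tendstoD(1)) auto
  moreover have "eventually (\<lambda>n. \<rho> (Suc n) < \<theta> / 3) sequentially"
    using \<theta>0 by (intro order_tendstoD(2)[OF LIMSEQ_Suc[OF rho_lim]]) simp
  moreover have "eventually (\<lambda>n. \<gamma> n < 1 / \<kappa>) sequentially"
    using \<kappa>0 by (intro order_tendstoD(2)[OF gamma_lim]) simp
  ultimately have "eventually (\<lambda>n. 1 \<le> n \<and> \<kappa> * b < \<rho> (Suc n) / \<rho> n * (?q - \<theta> * \<rho> (Suc n))
      + b * ((\<rho> n / \<gamma> n - \<rho> (Suc n) / \<gamma> (Suc n)) / \<rho> n) \<and> \<rho> (Suc n) < \<theta> / 3 \<and> \<gamma> n < 1 / \<kappa>) sequentially"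
    using eventually_ge_1 by eventually_elim simp
  then obtain N\<^sub>0 where N\<^sub>0: "\<And>n. N\<^sub>0 \<le> n \<Longrightarrow> 1 \<le> n \<and> \<kappa> * b < \<rho> (Suc n) / \<rho> n * (?q - \<theta> * \<rho> (Suc n))
      + b * ((\<rho> n / \<gamma> n - \<rho> (Suc n) / \<gamma> (Suc n)) / \<rho> n) \<and> \<rho> (Suc n) < \<theta> / 3 \<and> \<gamma> n < 1 / \<kappa>"
    unfolding eventually_sequentially by blast
  then have N1: "1 \<le> N\<^sub>0" by simp
  have "\<exists>K. \<forall>n\<ge>N\<^sub>0. expectation (\<lambda>\<omega>. indicator (staying N\<^sub>0 n UNIV) \<omega> *
    exp (\<theta> / \<gamma> n * (- 1 * (1 - X n \<omega> - b * \<rho> n)))) \<le> K"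
  proof (rule exponential_moment_bound[where \<kappa> = \<kappa>])
    fix n assume n: "N\<^sub>0 \<le> n"
    note facts = N\<^sub>0[OF n]
    have \<gamma>: "0 < \<gamma> n" "0 < \<gamma> (Suc n)" "\<gamma> (Suc n) \<le> \<gamma> n" and \<rho>: "0 < \<rho> n" "0 < \<rho> (Suc n)"
      using facts gamma_pos rho_pos gamma_decreasing by auto
    show "\<rho> (Suc n) \<le> 1" using facts \<theta>1 by simp
    show "\<kappa> * \<gamma> n \<le> 1" using facts \<kappa>0 by (simp add: field_simps)
    fix z :: real assume z: "z \<in> {0..1}"
    define y where "y = 1 - z"
    have y: "0 \<le> y" "y \<le> 1" using z by (auto simp: y_def)
    let ?g = "\<gamma> (Suc n)" and ?r = "\<rho> (Suc n)"
    let ?e = "\<rho> n / \<gamma> n - ?r / ?g"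
    have balance: "\<kappa> * b * \<rho> n \<le> ?r * (?q - \<theta> * ?r) + b * ?e"
    proof -
      have "\<rho> n * (\<kappa> * b) \<le> \<rho> n * (?r / \<rho> n * (?q - \<theta> * ?r) + b * (?e / \<rho> n))"
        using facts \<rho> by (intro mult_left_mono) auto
      then show ?thesis
        using \<rho> by (simp only: distrib_left) (simp add: mult_ac)
    qed
    have slope: "y * (1 / \<gamma> n) \<le> y * (1 / ?g)"
      using \<gamma> y by (intro mult_left_mono divide_left_mono) auto
    have bend: "(?\<pi> + \<theta>) * z * y \<le> (?\<pi> + \<theta>) * 1 * y"
      using y \<pi> \<theta>0 by (intro mult_right_mono mult_left_mono) (auto simp: y_def)
    have push: "?r * ?q - 2 * ?r * y \<le> ?r * (?q * z\<^sup>2)"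
    proof -
      have "?q * (1 - 2 * y) \<le> ?q * z\<^sup>2"
        using q zero_le_power2[of y] by (intro mult_left_mono) (auto simp: y_def power2_eq_square algebra_simps)
      moreover have "?q * y \<le> 1 * y"
        using q y by (intro mult_right_mono) auto
      ultimately have "?q - 2 * y \<le> ?q * z\<^sup>2"
        by (simp add: algebra_simps)
      then have "?r * (?q - 2 * y) \<le> ?r * (?q * z\<^sup>2)"
        using \<rho> by (intro mult_left_mono) auto
      then show ?thesis by (simp add: algebra_simps)
    qed
    have reward: "?r * ((1 - p\<^sub>B) * y\<^sup>2) \<le> ?r * (1 * y)"
      using \<rho> p_bounds y by (intro mult_left_mono mult_mono) (auto simp: power2_eq_square mult_left_le)
    have small: "3 * ?r * y \<le> \<theta> * y"
      using facts y by (intro mult_right_mono) auto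
    have drift: "drift (Suc n) z = ?\<pi> * z * y - ?r * (?q * z\<^sup>2) + ?r * ((1 - p\<^sub>B) * y\<^sup>2)"
      unfolding drift_def y_def by (simp add: right_diff_distrib)
    have \<kappa>y: "\<kappa> * y = (?\<pi> + \<theta>) * 1 * y + \<theta> * y"
      by (simp add: \<kappa>_def algebra_simps)
    \<comment> \<open>The contraction hypothesis divided by \<open>\<theta>\<close>, with its terms grouped as in the upper bound and the opposite signs.\<close>
    have "(b * ?r - y) / ?g + drift (Suc n) z + \<theta> * (z * y + ?r\<^sup>2) - (1 / \<gamma> n - \<kappa>) * (b * \<rho> n - y)
        = (y * (1 / \<gamma> n) - y * (1 / ?g)) + \<kappa> * b * \<rho> n - (?r * (?q - \<theta> * ?r) + b * ?e)
          + (?\<pi> + \<theta>) * z * y - \<kappa> * y + ?r * ?q - ?r * (?q * z\<^sup>2) + ?r * ((1 - p\<^sub>B) * y\<^sup>2)"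
      unfolding drift by (simp add: algebra_simps diff_divide_distrib power2_eq_square)
    also have "\<dots> \<le> 0"
      using balance slope bend push reward small \<kappa>y by simp
    finally have *: "(b * ?r - y) / ?g + drift (Suc n) z + \<theta> * (z * y + ?r\<^sup>2) \<le> (1 / \<gamma> n - \<kappa>) * (b * \<rho> n - y)"
      by simp
    have "\<theta> / ?g * (- 1 * (1 - z - b * ?r)) - (- 1) * \<theta> * drift (Suc n) z + \<theta>\<^sup>2 * (z * (1 - z) + ?r\<^sup>2)
        = \<theta> * ((b * ?r - y) / ?g + drift (Suc n) z + \<theta> * (z * y + ?r\<^sup>2))"
      by (simp add: y_def algebra_simps diff_divide_distrib add_divide_distrib power2_eq_square)
    also have "\<dots> \<le> \<theta> * ((1 / \<gamma> n - \<kappa>) * (b * \<rho> n - y))"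
      using * \<theta>0 by (intro mult_left_mono) auto
    also have "\<dots> = (1 - \<kappa> * \<gamma> n) * (\<theta> / \<gamma> n * (- 1 * (1 - z - b * \<rho> n)))"
      using \<gamma> by (simp add: y_def field_simps)
    finally show "\<theta> / ?g * (- 1 * (1 - z - b * ?r)) - (- 1) * \<theta> * drift (Suc n) z + \<theta>\<^sup>2 * (z * (1 - z) + ?r\<^sup>2)
        \<le> (1 - \<kappa> * \<gamma> n) * (\<theta> / \<gamma> n * (- 1 * (1 - z - b * \<rho> n)))" .
  qed (use \<theta>0 \<theta>1 \<kappa>0 N1 in auto)
  then obtain K where K: "\<And>n. N\<^sub>0 \<le> n \<Longrightarrow> expectation (\<lambda>\<omega>. indicator (staying N\<^sub>0 n UNIV) \<omega> *
      exp (\<theta> / \<gamma> n * (- 1 * (1 - X n \<omega> - b * \<rho> n)))) \<le> K"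
    by blast
  have "AE \<omega> in M. (\<forall>n\<ge>N\<^sub>0. X n \<omega> \<in> UNIV) \<longrightarrow>
      eventually (\<lambda>n. - 1 * (1 - X n \<omega> - b * \<rho> n) \<le> (b - c) * \<rho> n) sequentially"
    by (rule AE_eventually_le[OF \<theta>0 N1 _ _ K])
      (use b0 \<theta>0 exp_rho_gamma[of "\<theta> * (b - c)"] in auto)
  then show ?thesis
  proof (rule AE_mp, intro AE_I2 impI)
    fix \<omega>
    assume "(\<forall>n\<ge>N\<^sub>0. X n \<omega> \<in> UNIV) \<longrightarrow>
      eventually (\<lambda>n. - 1 * (1 - X n \<omega> - b * \<rho> n) \<le> (b - c) * \<rho> n) sequentially"
    then have "eventually (\<lambda>n. - 1 * (1 - X n \<omega> - b * \<rho> n) \<le> (b - c) * \<rho> n) sequentially"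
      by simp
    then show "eventually (\<lambda>n. c \<le> (1 - X n \<omega>) / \<rho> n) sequentially"
      using eventually_ge_1
    proof eventually_elim
      case (elim n)
      then show ?case
        using rho_pos[of n] by (simp add: field_simps)
    qed
  qed
qed

lemma AE_rate: "AE \<omega> in M. (\<lambda>n. (1 - X n \<omega>) / \<rho> n) \<longlonglongrightarrow> (1 - p\<^sub>A) / (p\<^sub>A - p\<^sub>B)"
proof -
  let ?L = "(1 - p\<^sub>A) / (p\<^sub>A - p\<^sub>B)"
  have "AE \<omega> in M. \<forall>i::nat. eventually (\<lambda>n. (1 - X n \<omega>) / \<rho> n \<le> ?L + inverse (Suc i)) sequentially
      \<and> eventually (\<lambda>n. ?L - inverse (Suc i) \<le> (1 - X n \<omega>) / \<rho> n) sequentially"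
    unfolding AE_all_countable AE_conj_iff by (intro allI conjI AE_upper_bound AE_lower_bound) simp_all
  then show ?thesis
  proof (rule AE_mp, intro AE_I2 impI)
    fix \<omega>
    assume bounds: "\<forall>i::nat. eventually (\<lambda>n. (1 - X n \<omega>) / \<rho> n \<le> ?L + inverse (Suc i)) sequentially
      \<and> eventually (\<lambda>n. ?L - inverse (Suc i) \<le> (1 - X n \<omega>) / \<rho> n) sequentially"
    show "(\<lambda>n. (1 - X n \<omega>) / \<rho> n) \<longlonglongrightarrow> ?L"
    proof (rule tendstoI)
      fix e :: real assume "0 < e"
      then obtain i where i: "inverse (real (Suc i)) < e"
        using reals_Archimedean by blast
      have "eventually (\<lambda>n. (1 - X n \<omega>) / \<rho> n \<le> ?L + inverse (Suc i)) sequentially"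
        "eventually (\<lambda>n. ?L - inverse (Suc i) \<le> (1 - X n \<omega>) / \<rho> n) sequentially"
        using bounds by auto
      then show "eventually (\<lambda>n. dist ((1 - X n \<omega>) / \<rho> n) ?L < e) sequentially"
        by eventually_elim (use i in \<open>simp only: dist_real_def abs_less_iff; linarith\<close>)
    qed
  qed
qed

end

theorem theorem3:
  fixes M :: "'a measure"
    and p\<^sub>A p\<^sub>B x :: real
    and \<gamma> \<rho> :: "nat \<Rightarrow> real"
    and U X :: "nat \<Rightarrow> 'a \<Rightarrow> real"
    and A B :: "nat \<Rightarrow> 'a set"
  assumes bandit: "penalized_bandit M p\<^sub>A p\<^sub>B \<gamma> \<rho> U A B x X"
    and rho_lim: "\<rho> \<longlonglongrightarrow> 0"
    and gamma_rho_lim: "(\<lambda>n. \<gamma> n / \<rho> n) \<longlonglongrightarrow> 0"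
    and rho_gamma_sum: "filterlim (\<lambda>N. \<Sum>n=1..N. \<rho> n * \<gamma> n) at_top sequentially"
    and rho_diff: "(\<lambda>n. \<rho> n - \<rho> (n - 1)) \<in> o(\<lambda>n. \<rho> n * \<gamma> n)"
    and gamma_rho_diff: "\<And>\<beta>. \<beta> \<in> {0..1} \<Longrightarrow>
          (\<lambda>n. \<gamma> n * \<rho> n powr \<beta> - \<gamma> (n - 1) * \<rho> (n - 1) powr \<beta>)
            \<in> o(\<lambda>n. (\<gamma> n)\<^sup>2 * \<rho> n powr \<beta>)"
    and exp_sum: "\<exists>\<eta>>0. \<forall>C>0. summable (\<lambda>n. exp (- C * (\<rho> n powr (1 + \<eta>) / \<gamma> n)))"
  shows "AE \<omega> in M. (\<lambda>n. (1 - X n \<omega>) / \<rho> n) \<longlonglongrightarrow> (1 - p\<^sub>A) / (p\<^sub>A - p\<^sub>B)"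
proof -
  interpret penalized_bandit M p\<^sub>A p\<^sub>B \<gamma> \<rho> U A B x X
    by (rule bandit)
  have eventually_ge_1: "eventually (\<lambda>n::nat. 1 \<le> n) sequentially"
    by (rule eventually_ge_at_top)
  have rho_increment: "(\<lambda>n. (\<rho> (Suc n) - \<rho> n) / (\<rho> (Suc n) * \<gamma> (Suc n))) \<longlonglongrightarrow> 0"
    using LIMSEQ_Suc[OF smalloD_tendsto[OF rho_diff]] by simp
  have gamma_increment: "(\<lambda>n. (\<gamma> (Suc n) - \<gamma> n) / (\<gamma> (Suc n))\<^sup>2) \<longlonglongrightarrow> 0"
  proof -
    have "(\<lambda>n. (\<gamma> (Suc n) * \<rho> (Suc n) powr 0 - \<gamma> n * \<rho> n powr 0) / ((\<gamma> (Suc n))\<^sup>2 * \<rho> (Suc n) powr 0)) \<longlonglongrightarrow> 0"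
      using LIMSEQ_Suc[OF smalloD_tendsto[OF gamma_rho_diff[of 0]]] by simp
    moreover have "eventually (\<lambda>n. (\<gamma> (Suc n) * \<rho> (Suc n) powr 0 - \<gamma> n * \<rho> n powr 0) / ((\<gamma> (Suc n))\<^sup>2 * \<rho> (Suc n) powr 0)
        = (\<gamma> (Suc n) - \<gamma> n) / (\<gamma> (Suc n))\<^sup>2) sequentially"
      using eventually_ge_1
    proof eventually_elim
      case (elim n)
      then show ?case using rho_pos[of n] rho_pos[of "Suc n"] by simp
    qed
    ultimately show ?thesis
      by (rule Lim_transform_eventually)
  qed
  have exp_rho_gamma: "summable (\<lambda>n. exp (- C * (\<rho> n / \<gamma> n)))" if C: "0 < C" for C
  proof -
    obtain \<eta> where \<eta>: "0 < \<eta>" and sum: "summable (\<lambda>n. exp (- C * (\<rho> n powr (1 + \<eta>) / \<gamma> n)))"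
      using exp_sum C by blast
    have "eventually (\<lambda>n. \<rho> n < 1) sequentially"
      by (rule order_tendstoD(2)[OF rho_lim]) simp
    then have "eventually (\<lambda>n. norm (exp (- C * (\<rho> n / \<gamma> n))) \<le> exp (- C * (\<rho> n powr (1 + \<eta>) / \<gamma> n))) sequentially"
      using eventually_ge_1
    proof eventually_elim
      case (elim n)
      then have pos: "0 < \<rho> n" "0 < \<gamma> n"
        using rho_pos gamma_pos by auto
      have "\<rho> n powr (1 + \<eta>) \<le> \<rho> n powr 1"
        using pos elim \<eta> by (intro powr_mono') auto
      then have "C * (\<rho> n powr (1 + \<eta>) / \<gamma> n) \<le> C * (\<rho> n / \<gamma> n)"
        using pos C by (intro mult_left_mono divide_right_mono) auto
      then show ?case by simp
    qed
    then show ?thesis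
      by (rule summable_comparison_test_ev) (rule sum)
  qed
  interpret slowly_varying_bandit M p\<^sub>A p\<^sub>B \<gamma> \<rho> U A B x X
    by unfold_locales (fact rho_lim gamma_rho_lim rho_gamma_sum rho_increment gamma_increment exp_rho_gamma)+
  show ?thesis
    by (rule AE_rate)
qed

end
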